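(* Let $\varphi\in L^2(\mathbb{R}^2,\mathbb{H})$ be nonzero and let $f\in L^2(\mathbb{R}^2,\mathbb{H})$. Then $$f(x)=\frac{1}{\|\varphi\|^2_{L^2(\mathbb{R}^2,\mathbb{H})}}\int_{\mathbb{R}^2}\int_{\mathbb{R}^2}K^{-i}_{A_1}(x_1,\omega_1)\,\mathcal{G}^{\varphi}_{A_1,A_2}\{f\}(\omega,y)\,K^{-j}_{A_2}(x_2,\omega_2)\,\varphi(x-y)\,d\omega\,dy .$$
   Context: $\mathbb{H}$ is the algebra of real quaternions with units $i,j,k$, conjugation $\overline{q}$ and modulus $|q|=\sqrt{q\overline{q}}$. $L^2(\mathbb{R}^2,\mathbb{H})$ is the space of functions $f:\mathbb{R}^2\to\mathbb{H}$ with $\|f\|_{L^2(\mathbb{R}^2,\mathbb{H})}^2=\int_{\mathbb{R}^2}|f(x)|^2dx<\infty$. Fix real $2\times 2$ matrices $A_l=\begin{pmatrix}a_l&b_l\\c_l&d_l\end{pmatrix}$, $l=1,2$, with $a_ld_l-b_lc_l=1$ and $b_1b_2\neq 0$. Kernels: $K^{i}_{A_1}(x_1,\omega_1)=\frac{1}{\sqrt{2\pi b_1}}e^{\frac{i}{2}\left(\frac{a_1}{b_1}x_1^2-\frac{2}{b_1}x_1\omega_1+\frac{d_1}{b_1}\omega_1^2-\frac{\pi}{2}\right)}$ and $K^{j}_{A_2}(x_2,\omega_2)=\frac{1}{\sqrt{2\pi b_2}}e^{\frac{j}{2}\left(\frac{a_2}{b_2}x_2^2-\frac{2}{b_2}x_2\omega_2+\frac{d_2}{b_2}\omega_2^2-\frac{\pi}{2}\right)}$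 (for negative $b_1$, resp. $b_2$, the square root is the principal one in $\mathbb{R}+\mathbb{R}i$, resp. $\mathbb{R}+\mathbb{R}j$). $K^{-i}_{A_1}$ and $K^{-j}_{A_2}$ are obtained by replacing $i$ by $-i$ and $j$ by $-j$. For a window $\varphi$, the Gabor quaternion linear canonical transform of $f$ is $$\mathcal{G}^{\varphi}_{A_1,A_2}\{f\}(\omega,y)=\int_{\mathbb{R}^2}K^{i}_{A_1}(x_1,\omega_1)f(x)\overline{\varphi(x-y)}K^{j}_{A_2}(x_2,\omega_2)\,dx,\qquad \omega,y\in\mathbb{R}^2$$ (for $f,\varphi\in L^2(\mathbb{R}^2,\mathbb{H})$). *)

theory Defs
  imports "HOL-Analysis.Analysis"
begin

section \<open>Quaternions\<close>

datatype quat = Quat (qRe: real) (qIm1: real) (qIm2: real) (qIm3: real)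

lemma quat_eq_iff:
  "p = q \<longleftrightarrow> qRe p = qRe q \<and> qIm1 p = qIm1 q \<and> qIm2 p = qIm2 q \<and> qIm3 p = qIm3 q"
  by (cases p; cases q) simp

instantiation quat :: real_inner
begin

definition zero_quat :: quat where "0 = Quat 0 0 0 0"

definition plus_quat :: "quat \<Rightarrow> quat \<Rightarrow> quat" where
  "p + q = Quat (qRe p + qRe q) (qIm1 p + qIm1 q) (qIm2 p + qIm2 q) (qIm3 p + qIm3 q)"

definition uminus_quat :: "quat \<Rightarrow> quat" where
  "- p = Quat (- qRe p) (- qIm1 p) (- qIm2 p) (- qIm3 p)"

definition minus_quat :: "quat \<Rightarrow> quat \<Rightarrow> quat" where
  "p - q = Quat (qRe p - qRe q) (qIm1 p - qIm1 q) (qIm2 p - qIm2 q) (qIm3 p - qIm3 q)"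

definition scaleR_quat :: "real \<Rightarrow> quat \<Rightarrow> quat" where
  "r *\<^sub>R p = Quat (r * qRe p) (r * qIm1 p) (r * qIm2 p) (r * qIm3 p)"

definition inner_quat :: "quat \<Rightarrow> quat \<Rightarrow> real" where
  "inner p q = qRe p * qRe q + qIm1 p * qIm1 q + qIm2 p * qIm2 q + qIm3 p * qIm3 q"

definition norm_quat :: "quat \<Rightarrow> real" where "norm p = sqrt (inner p (p::quat))"

definition sgn_quat :: "quat \<Rightarrow> quat" where "sgn p = inverse (norm p) *\<^sub>R (p::quat)"

definition dist_quat :: "quat \<Rightarrow> quat \<Rightarrow> real" where "dist p q = norm (p - q :: quat)"

definition uniformity_quat :: "(quat \<times> quat) filter" where
  "uniformity_quat = (INF e\<in>{0<..}. principal {(x, y). dist x y < e})"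

definition open_quat :: "quat set \<Rightarrow> bool" where
  "open_quat U \<longleftrightarrow> (\<forall>x\<in>U. eventually (\<lambda>(x', y). x' = x \<longrightarrow> y \<in> U) uniformity)"

instance
proof
  fix p q r :: quat and s t :: real and U :: "quat set"
  show "p + q + r = p + (q + r)" "p + q = q + p" "0 + p = p" "- p + p = 0" "p - q = p + - q"
    "s *\<^sub>R (p + q) = s *\<^sub>R p + s *\<^sub>R q" "(s + t) *\<^sub>R p = s *\<^sub>R p + t *\<^sub>R p"
    "s *\<^sub>R t *\<^sub>R p = (s * t) *\<^sub>R p" "1 *\<^sub>R p = p"
    by (simp_all add: zero_quat_def plus_quat_def uminus_quat_def minus_quat_def scaleR_quat_def
        quat_eq_iff algebra_simps)
  show "inner p q = inner q p" "inner (p + q) r = inner p r + inner q r"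
    "inner (s *\<^sub>R p) q = s * inner p q"
    by (simp_all add: inner_quat_def plus_quat_def scaleR_quat_def algebra_simps)
  show "0 \<le> inner p p"
    by (simp add: inner_quat_def)
  have "inner p p = (qRe p)\<^sup>2 + (qIm1 p)\<^sup>2 + ((qIm2 p)\<^sup>2 + (qIm3 p)\<^sup>2)"
    by (simp add: inner_quat_def power2_eq_square)
  then show "inner p p = 0 \<longleftrightarrow> p = 0"
    by (simp add: quat_eq_iff zero_quat_def add_nonneg_eq_0_iff)
  show "sgn p = inverse (norm p) *\<^sub>R p"
    by (rule sgn_quat_def)
qed (rule norm_quat_def dist_quat_def uniformity_quat_def open_quat_def)+

end

lemma quat_sel [simp]:
  "qRe 0 = 0" "qIm1 0 = 0" "qIm2 0 = 0" "qIm3 0 = 0"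
  "qRe (p + q) = qRe p + qRe q" "qIm1 (p + q) = qIm1 p + qIm1 q"
  "qIm2 (p + q) = qIm2 p + qIm2 q" "qIm3 (p + q) = qIm3 p + qIm3 q"
  "qRe (- p) = - qRe p" "qIm1 (- p) = - qIm1 p"
  "qIm2 (- p) = - qIm2 p" "qIm3 (- p) = - qIm3 p"
  "qRe (p - q) = qRe p - qRe q" "qIm1 (p - q) = qIm1 p - qIm1 q"
  "qIm2 (p - q) = qIm2 p - qIm2 q" "qIm3 (p - q) = qIm3 p - qIm3 q"
  "qRe (r *\<^sub>R p) = r * qRe p" "qIm1 (r *\<^sub>R p) = r * qIm1 p"
  "qIm2 (r *\<^sub>R p) = r * qIm2 p" "qIm3 (r *\<^sub>R p) = r * qIm3 p"
  by (simp_all add: zero_quat_def plus_quat_def uminus_quat_def minus_quat_def scaleR_quat_def)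

lemma norm_quat_sq:
  "(norm (p::quat))\<^sup>2 = (qRe p)\<^sup>2 + (qIm1 p)\<^sup>2 + (qIm2 p)\<^sup>2 + (qIm3 p)\<^sup>2"
  unfolding power2_norm_eq_inner by (simp add: inner_quat_def power2_eq_square)

definition qcnj :: "quat \<Rightarrow> quat" where
  "qcnj p = Quat (qRe p) (- qIm1 p) (- qIm2 p) (- qIm3 p)"

lemma qcnj_sel [simp]:
  "qRe (qcnj p) = qRe p" "qIm1 (qcnj p) = - qIm1 p"
  "qIm2 (qcnj p) = - qIm2 p" "qIm3 (qcnj p) = - qIm3 p"
  by (simp_all add: qcnj_def)

instantiation quat :: real_normed_div_algebra
begin

definition one_quat :: quat where "1 = Quat 1 0 0 0"

definition times_quat :: "quat \<Rightarrow> quat \<Rightarrow> quat" where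
  "p * q = Quat
     (qRe p * qRe q - qIm1 p * qIm1 q - qIm2 p * qIm2 q - qIm3 p * qIm3 q)
     (qRe p * qIm1 q + qIm1 p * qRe q + qIm2 p * qIm3 q - qIm3 p * qIm2 q)
     (qRe p * qIm2 q - qIm1 p * qIm3 q + qIm2 p * qRe q + qIm3 p * qIm1 q)
     (qRe p * qIm3 q + qIm1 p * qIm2 q - qIm2 p * qIm1 q + qIm3 p * qRe q)"

definition inverse_quat :: "quat \<Rightarrow> quat" where
  "inverse p = (1 / (norm p)\<^sup>2) *\<^sub>R qcnj p"

definition divide_quat :: "quat \<Rightarrow> quat \<Rightarrow> quat" where
  "p div q = p * inverse (q::quat)"

instance
proof
  fix p q r :: quat and s :: real
  show "p * q * r = p * (q * r)" "(p + q) * r = p * r + q * r" "p * (q + r) = p * q + p * r"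
    "1 * p = p" "p * 1 = p" "s *\<^sub>R p * q = s *\<^sub>R (p * q)" "p * s *\<^sub>R q = s *\<^sub>R (p * q)"
    "(0::quat) \<noteq> 1"
    by (simp_all add: quat_eq_iff times_quat_def one_quat_def algebra_simps)
  show "p div q = p * inverse q"
    by (rule divide_quat_def)
  show "inverse (0::quat) = 0"
    by (simp add: inverse_quat_def)
  have *: "qcnj p * p = (norm p)\<^sup>2 *\<^sub>R 1" "p * qcnj p = (norm p)\<^sup>2 *\<^sub>R 1"
    unfolding norm_quat_sq
    by (simp_all add: quat_eq_iff times_quat_def one_quat_def power2_eq_square algebra_simps)
  have sc: "s *\<^sub>R p * q = s *\<^sub>R (p * q)" "p * s *\<^sub>R q = s *\<^sub>R (p * q)" for s :: real and p q :: quat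
    by (simp_all add: quat_eq_iff times_quat_def algebra_simps)
  show "inverse p * p = 1" "p * inverse p = 1" if "p \<noteq> 0"
    using that by (simp_all add: inverse_quat_def sc *)
  have "(norm (p * q))\<^sup>2 = (norm p * norm q)\<^sup>2"
    unfolding power_mult_distrib norm_quat_sq times_quat_def quat.sel by algebra
  then show "norm (p * q) = norm p * norm q"
    by simp
qed

end

lemma modulus_quat: "p * qcnj p = of_real ((norm p)\<^sup>2)"
  unfolding norm_quat_sq of_real_def quat_eq_iff
  by (simp add: times_quat_def one_quat_def power2_eq_square)

abbreviation qi :: quat where "qi \<equiv> Quat 0 1 0 0"
abbreviation qj :: quat where "qj \<equiv> Quat 0 0 1 0"
abbreviation qk :: quat where "qk \<equiv> Quat 0 0 0 1"

lemma quat_units: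
  "qi * qi = -1" "qj * qj = -1" "qk * qk = -1"
  "qi * qj = qk" "qj * qk = qi" "qk * qi = qj"
  "qj * qi = - qk" "qk * qj = - qi" "qi * qk = - qj"
  unfolding quat_eq_iff by (simp_all add: times_quat_def one_quat_def)

text \<open>This instance makes quaternion-valued Bochner integrals and the power series
  \<^const>\<open>exp\<close> available.\<close>

instantiation quat :: euclidean_space
begin

definition Basis_quat :: "quat set" where "Basis = {1, qi, qj, qk}"

instance
proof
  show "finite (Basis :: quat set)" "(Basis :: quat set) \<noteq> {}"
    by (simp_all add: Basis_quat_def)
  show "inner p q = (if p = q then 1 else 0)" if "p \<in> Basis" "q \<in> Basis" for p q :: quat
    using that unfolding Basis_quat_def one_quat_def inner_quat_def insert_iff empty_iff
    by (elim disjE; simp)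
  show "(\<forall>u\<in>Basis. inner p u = 0) \<longleftrightarrow> p = 0" for p :: quat
    unfolding Basis_quat_def quat_eq_iff inner_quat_def one_quat_def by auto
qed

end


section \<open>Square-integrable quaternion-valued functions on the plane\<close>

definition L2_quat :: "(real^2 \<Rightarrow> quat) \<Rightarrow> bool" where
  "L2_quat f \<longleftrightarrow>
     f \<in> borel_measurable lebesgue \<and> integrable lebesgue (\<lambda>x. (norm (f x))\<^sup>2)"

definition L2_norm :: "(real^2 \<Rightarrow> quat) \<Rightarrow> real" where
  "L2_norm f = sqrt (LINT x|lebesgue. (norm (f x))\<^sup>2)"


section \<open>The Gabor quaternion linear canonical transform\<close>

text \<open>For an imaginary unit \<open>u\<close>, the principal square root in the copy \<open>\<real> + \<real>u\<close> of the complex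
  plane of a real number.\<close>

definition qsqrt :: "quat \<Rightarrow> real \<Rightarrow> quat" where
  "qsqrt u r = (if r \<ge> 0 then of_real (sqrt r) else sqrt (- r) *\<^sub>R u)"

text \<open>The kernel \<open>K\<^sup>u\<^sub>A\<close> for the matrix \<open>A\<close> with rows \<open>(a, b)\<close> and \<open>(c, d)\<close>. Taking \<open>- u\<close> for \<open>u\<close>
  also replaces \<open>u\<close> in the square root.\<close>

definition qlct_kernel :: "quat \<Rightarrow> real^2^2 \<Rightarrow> real \<Rightarrow> real \<Rightarrow> quat" where
  "qlct_kernel u A x \<omega> =
     (let a = A $ 1 $ 1; b = A $ 1 $ 2; d = A $ 2 $ 2 in
      1 / qsqrt u (2 * pi * b) *
      exp ((1 / 2 * (a / b * x\<^sup>2 - 2 / b * x * \<omega> + d / b * \<omega>\<^sup>2 - pi / 2)) *\<^sub>R u))"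

definition gabor_qlct ::
  "real^2^2 \<Rightarrow> real^2^2 \<Rightarrow> (real^2 \<Rightarrow> quat) \<Rightarrow> (real^2 \<Rightarrow> quat) \<Rightarrow> real^2 \<Rightarrow> real^2 \<Rightarrow> quat" where
  "gabor_qlct A1 A2 \<phi> f \<omega> y =
     (LINT x|lebesgue. qlct_kernel qi A1 (x $ 1) (\<omega> $ 1) * f x * qcnj (\<phi> (x - y)) *
        qlct_kernel qj A2 (x $ 2) (\<omega> $ 2))"


section \<open>Integrals of function-valued maps in the mean-square sense\<close>

text \<open>
  For general square-integrable functions the integrand of the inversion formula is not Lebesgue
  integrable over all \<open>(\<omega>, y)\<close>, so, as for the Fourier inversion formula in \<open>L\<^sup>2\<close>, the double
  integral over \<open>(\<omega>, y)\<close> is a limit in \<open>L\<^sup>2\<close>.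
  \<open>has_L2_integral F g\<close> says that \<open>x \<mapsto> \<integral> F p x dp\<close> is \<open>g\<close> in this sense: over every bounded
  measurable set of parameters the integral is an absolutely convergent Lebesgue integral for
  almost every \<open>x\<close> and defines an \<open>L\<^sup>2\<close> function of \<open>x\<close>, and along every exhaustion of the
  parameter space by such sets these functions converge to \<open>g\<close> in the \<open>L\<^sup>2\<close> norm.
\<close>

definition has_L2_integral ::
  "('p::euclidean_space \<Rightarrow> real^2 \<Rightarrow> quat) \<Rightarrow> (real^2 \<Rightarrow> quat) \<Rightarrow> bool" where
  "has_L2_integral F g \<longleftrightarrow>
     L2_quat g \<and>
     (\<forall>K \<in> sets lebesgue. bounded K \<longrightarrow>
        (AE x in lebesgue. set_integrable lebesgue K (\<lambda>p. F p x)) \<and>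
        L2_quat (\<lambda>x. LINT p:K|lebesgue. F p x)) \<and>
     (\<forall>K :: nat \<Rightarrow> 'p set.
        (\<forall>n. K n \<in> sets lebesgue \<and> bounded (K n)) \<and> incseq K \<and> (\<Union>n. K n) = UNIV \<longrightarrow>
        (\<lambda>n. L2_norm (\<lambda>x. (LINT p:K n|lebesgue. F p x) - g x)) \<longlonglongrightarrow> 0)"

end

(*
  The adjoint argument for tight frames. Inserting a Gaussian weight exp(-s^2 |v|^2 / 2), Fubini's
  theorem and the continuity of translations in L^2 give a Plancherel identity for the two-sided
  quaternionic Fourier transform; the two complex structures (left multiplication by i, right
  multiplication by j) never have to commute with the values of the function, since real inner products
  move unit factors to the other side. A chirp multiplication and a dilation turn it into Plancherel
  for the linear canonical transform, and integration over the window position y shows that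
  G f = gabor_qlct A1 A2 phi f satisfies <G f, G h> = |phi|^2 <f, h>. Integrating the integrand of the
  inversion formula over a bounded K gives G* (1_K G f), and since G* G = |phi|^2, its distance from
  |phi|^2 f is at most |phi| times the L^2 norm of G f outside K, which vanishes along an exhaustion.
*)

theory Submission
  imports Defs "HOL-Probability.Characteristic_Functions"
begin

section \<open>Quaternion exponentials and kernels\<close>

text \<open>Two facts keep the argument free of density extensions. A product of two
  square-integrable functions is integrable, so the transform is a convergent integral at every
  \<open>(\<omega>, y)\<close>, and Plancherel is needed only for functions that are both integrable
  and square-integrable; the windowed slices of \<open>f\<close> are such for almost every
  \<open>y\<close>. On the synthesis side the integrand is, up to a constant, bounded by
  \<open>norm (G f p) * norm (\<phi> (x - snd p))\<close>, hence integrable once \<omega> is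
  confined to a ball, while \<open>y\<close> may range over the whole plane. The obstacle is that
  the resulting bound is uniform in \<open>x\<close> and shows no decay, so a partial synthesis
  integral is not visibly square-integrable. Its square-integrability and the error estimate are
  obtained together, by testing the error against bounded truncations of itself. All inner products
  are real-valued, so polarisation has a single mixed term. Fubini's theorem is applied to products
  of Borel measures, so the work is done for Borel representatives and transferred to Lebesgue
  measurable functions at the end.\<close>

lemma inner_qmult: "inner (a * p * b) q = inner p (qcnj a * q * qcnj (b::quat))"
  by (simp add: inner_quat_def times_quat_def algebra_simps)

lemma norm_qcnj [simp]: "norm (qcnj p) = norm p"
  by (simp add: norm_eq_sqrt_inner inner_quat_def)

lemma qcnj_add: "qcnj (p + q) = qcnj p + qcnj q"
  by (simp add: quat_eq_iff)

lemma qcnj_scaleR [simp]: "qcnj (r *\<^sub>R p) = r *\<^sub>R qcnj p"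
  by (simp add: quat_eq_iff)

lemma qcnj_mult: "qcnj (p * q) = qcnj q * qcnj p"
  by (simp add: quat_eq_iff times_quat_def algebra_simps)

lemma qcnj_qcnj [simp]: "qcnj (qcnj p) = p"
  by (simp add: quat_eq_iff)

lemma qcnj_one [simp]: "qcnj 1 = 1"
  by (simp add: quat_eq_iff one_quat_def)

lemma qcnj_of_real [simp]: "qcnj (of_real r) = of_real r"
  by (simp add: of_real_def)

lemma qcnj_inverse: "qcnj (inverse p) = inverse (qcnj p)"
  by (simp add: inverse_quat_def)

lemma bounded_linear_qcnj: "bounded_linear qcnj"
  by (rule bounded_linear_intro[where K=1]) (simp_all add: qcnj_add)

lemma measurable_qcnj [measurable]: "qcnj \<in> borel_measurable borel"
  by (intro borel_measurable_continuous_onI linear_continuous_on bounded_linear_qcnj)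

section \<open>Exponentials of imaginary units\<close>

text \<open>Because \<open>u * u = -1\<close>, sending \<open>z\<close> to
  \<open>Re z *\<^sub>R 1 + Im z *\<^sub>R u\<close> is a continuous homomorphism of real algebras.
  It carries the power series of the complex exponential to that of the quaternion one, so Euler's
  formula is inherited.\<close>

lemma exp_imaginary_unit:
  fixes u :: quat
  assumes u: "u * u = -1"
  shows "exp (r *\<^sub>R u) = cos r *\<^sub>R 1 + sin r *\<^sub>R u"
proof -
  define \<psi> where "\<psi> z = Re z *\<^sub>R (1::quat) + Im z *\<^sub>R u" for z
  have bl: "bounded_linear \<psi>"
    unfolding \<psi>_def by (intro bounded_linear_add bounded_linear_scaleR_const[THEN bounded_linear_compose]
        bounded_linear_Re bounded_linear_Im bounded_linear_scaleR_left bounded_linear_compose[OF bounded_linear_scaleR_left])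
  interpret bounded_linear \<psi> by (rule bl)
  have mult: "\<psi> (z * w) = \<psi> z * \<psi> w" for z w
    using u by (simp add: \<psi>_def algebra_simps)
  have pow: "\<psi> (z ^ n) = \<psi> z ^ n" for z n
    by (induction n) (auto simp: mult, simp add: \<psi>_def)
  have "(\<lambda>n. \<psi> ((\<i> * r) ^ n /\<^sub>R fact n)) sums \<psi> (exp (\<i> * r))"
    by (intro sums exp_converges)
  moreover have "\<psi> (\<i> * r) = r *\<^sub>R u"
    by (simp add: \<psi>_def)
  ultimately have "(\<lambda>n. (r *\<^sub>R u) ^ n /\<^sub>R fact n) sums \<psi> (exp (\<i> * r))"
    by (simp only: scaleR pow)
  moreover have "(\<lambda>n. (r *\<^sub>R u) ^ n /\<^sub>R fact n) sums exp (r *\<^sub>R u)"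
    by (rule exp_converges)
  ultimately have "exp (r *\<^sub>R u) = \<psi> (exp (\<i> * r))"
    by (rule sums_unique2[symmetric])
  then show ?thesis
    by (simp add: \<psi>_def exp_eq_polar)
qed

lemma exp_scaleR_add: "exp ((r + s) *\<^sub>R u) = exp (r *\<^sub>R u) * exp (s *\<^sub>R (u::quat))"
  by (simp add: scaleR_add_left exp_add_commuting)

lemma qcnj_exp:
  assumes "u * u = -1" "qcnj u = - u"
  shows "qcnj (exp (r *\<^sub>R u)) = exp (- r *\<^sub>R u)"
  unfolding exp_imaginary_unit[OF assms(1)] by (simp add: assms(2) qcnj_add)

lemma norm_exp_imaginary_unit:
  assumes "u * u = -1" "qcnj u = - u"
  shows "norm (exp (r *\<^sub>R u)) = 1"
proof -
  have "of_real ((norm (exp (r *\<^sub>R u)))\<^sup>2) = exp (r *\<^sub>R u) * exp (- r *\<^sub>R u)"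
    using qcnj_exp[OF assms, of r] modulus_quat[of "exp (r *\<^sub>R u)"] by simp
  also have "\<dots> = (1::quat)"
    by (metis exp_scaleR_add add.right_inverse scaleR_zero_left exp_zero)
  finally show ?thesis
    by (simp only: of_real_eq_1_iff abs_square_eq_1 abs_norm_cancel)
qed

lemma measurable_exp_scaleR [measurable]: "(\<lambda>r. exp (r *\<^sub>R (u::quat))) \<in> borel_measurable borel"
proof (rule borel_measurable_continuous_onI)
  have "isCont (\<lambda>r. exp (r *\<^sub>R u)) r" for r
    by (rule has_vector_derivative_continuous) (rule exp_scaleR_has_vector_derivative_right)
  then show "continuous_on UNIV (\<lambda>r. exp (r *\<^sub>R u))"
    by (simp add: continuous_at_imp_continuous_on)
qed

lemma unit_qi [simp]: "qi * qi = -1" "qcnj qi = - qi" and unit_qj [simp]: "qj * qj = -1" "qcnj qj = - qj"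
  by (simp_all add: quat_units quat_eq_iff)

lemma norm_quat_unit:
  assumes "(u::quat) * u = -1" shows "norm u = 1"
proof -
  have "norm (u * u) = 1"
    unfolding assms by simp
  then have "(norm u)\<^sup>2 = 1"
    by (simp only: norm_mult power2_eq_square)
  then show ?thesis
    by (simp only: abs_square_eq_1 abs_norm_cancel)
qed

section \<open>The one-dimensional kernels\<close>

text \<open>The root and the exponential lie in the commutative algebra spanned by \<open>1\<close>
  and \<open>u\<close>; multiplying by the inverse on both sides passes the commutation on to it. If
  the root is \<open>0\<close>, both sides vanish since \<open>inverse 0 = 0\<close>.\<close>

lemma inverse_qsqrt_commute:
  assumes u: "u * u = -1"
  shows "inverse (qsqrt u r) * exp (s *\<^sub>R u) = exp (s *\<^sub>R u) * inverse (qsqrt u r)"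
proof (cases "qsqrt u r = 0")
  case False
  have comm: "qsqrt u r * exp (s *\<^sub>R u) = exp (s *\<^sub>R u) * qsqrt u r"
    by (simp add: qsqrt_def exp_imaginary_unit[OF u] of_real_def algebra_simps)
  have "inverse (qsqrt u r) * exp (s *\<^sub>R u)
      = inverse (qsqrt u r) * (exp (s *\<^sub>R u) * qsqrt u r) * inverse (qsqrt u r)"
    using False by (simp add: mult.assoc)
  also have "\<dots> = exp (s *\<^sub>R u) * inverse (qsqrt u r)"
    using False unfolding comm[symmetric] mult.assoc[symmetric] by simp
  finally show ?thesis .
qed simp

text \<open>Conjugation reverses products, but prefactor and exponential commute, and the root is
  conjugated as well since it lies in the plane of \<open>u\<close>. This makes the kernels of the
  inversion formula the adjoints of those of the transform.\<close>

lemma qlct_kernel_minus: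
  assumes "u * u = -1" "qcnj u = - u"
  shows "qlct_kernel (- u) A x w = qcnj (qlct_kernel u A x w)"
proof -
  define t where "t = 1 / 2 * (A$1$1 / A$1$2 * x\<^sup>2 - 2 / A$1$2 * x * w + A$2$2 / A$1$2 * w\<^sup>2 - pi / 2)"
  define c where "c = inverse (qsqrt u (2 * pi * A$1$2))"
  have c: "inverse (qsqrt (- u) (2 * pi * A$1$2)) = qcnj c"
    using assms(2) by (simp add: c_def qsqrt_def qcnj_inverse)
  have K: "qlct_kernel v A x w = inverse (qsqrt v (2 * pi * A$1$2)) * exp (t *\<^sub>R v)" for v
    by (simp only: qlct_kernel_def t_def Let_def inverse_eq_divide)
  have "qlct_kernel (- u) A x w = qcnj c * exp (t *\<^sub>R (- u))"
    by (simp only: K c)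
  also have "exp (t *\<^sub>R (- u)) = qcnj (exp (t *\<^sub>R u))"
    by (simp add: qcnj_exp[OF assms])
  also have "qcnj c * qcnj (exp (t *\<^sub>R u)) = qcnj (qlct_kernel u A x w)"
    unfolding K inverse_qsqrt_commute[OF assms(1)] qcnj_mult c_def ..
  finally show ?thesis .
qed

lemma norm_qsqrt: 
  assumes "u * u = -1" shows "norm (qsqrt u r) = sqrt \<bar>r\<bar>"
  by (simp add: qsqrt_def norm_quat_unit[OF assms])

lemma norm_qlct_kernel:
  assumes "u * u = -1" "qcnj u = - u"
  shows "norm (qlct_kernel u A x w) = 1 / sqrt (2 * pi * \<bar>A$1$2\<bar>)"
proof -
  have "norm (1 / q) = 1 / norm q" for q :: quat
    by (simp only: divide_inverse norm_inverse norm_mult norm_one)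
  then show ?thesis
    by (simp add: qlct_kernel_def Let_def norm_mult norm_qsqrt[OF assms(1)]
        norm_exp_imaginary_unit[OF assms] abs_mult)
qed

lemma measurable_qlct_kernel [measurable (raw)]:
  assumes [measurable]: "f \<in> borel_measurable M" "g \<in> borel_measurable M"
  shows "(\<lambda>x. qlct_kernel u A (f x) (g x)) \<in> borel_measurable M"
proof -
  have "(\<lambda>x. exp ((1 / 2 * (a / b * (f x)\<^sup>2 - 2 / b * f x * g x + d / b * (g x)\<^sup>2 - pi / 2)) *\<^sub>R u))
      \<in> borel_measurable M" for a b d
    by measurable
  then show ?thesis
    unfolding qlct_kernel_def Let_def by (intro borel_measurable_times borel_measurable_const)
qed

section \<open>Gaussian integrals\<close>

text \<open>Lebesgue measure on \<open>real^2\<close> is the image of a product measure indexed by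
  \<open>Basis\<close>, so the integral factors over the two basis vectors.\<close>

lemma has_bochner_integral_lborel_prod2:
  fixes f g :: "real \<Rightarrow> real"
  assumes f: "has_bochner_integral lborel f a" and g: "has_bochner_integral lborel g b"
  shows "has_bochner_integral lborel (\<lambda>v::real^2. f (v $ 1) * g (v $ 2)) (a * b)"
proof -
  define F where "F e = (if e = axis (1::2) (1::real) then f else g)" for e
  interpret product_sigma_finite "\<lambda>_::real^2. lborel :: real measure" ..
  have ne: "axis (2::2) (1::real) \<noteq> axis 1 1"
    by (simp add: axis_eq_axis)
  have B: "(Basis :: (real^2) set) = {axis 1 1, axis 2 1}"
    by (auto simp: Basis_vec_def UNIV_2)
  have [measurable]: "f \<in> borel_measurable borel" "g \<in> borel_measurable borel"
    using borel_measurable_has_bochner_integral[OF f] borel_measurable_has_bochner_integral[OF g] by simp_all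
  have int: "integrable lborel (F e)" for e
    using f g by (auto simp: F_def has_bochner_integral_iff)
  have I: "integrable (Pi\<^sub>M Basis (\<lambda>_::real^2. lborel)) (\<lambda>x. \<Prod>e\<in>Basis. F e (x e))"
    by (intro product_integrable_prod int) auto
  have L: "(\<integral>x. (\<Prod>e\<in>Basis. F e (x e)) \<partial>Pi\<^sub>M Basis (\<lambda>_::real^2. lborel)) = (\<Prod>e\<in>Basis. integral\<^sup>L lborel (F e))"
    by (intro product_integral_prod int) auto
  have R: "(\<Prod>e\<in>Basis. integral\<^sup>L lborel (F e)) = a * b"
    using f g ne by (simp add: B F_def has_bochner_integral_iff)
  have eq: "f ((\<Sum>e\<in>Basis. x e *\<^sub>R e) $ 1) * g ((\<Sum>e\<in>Basis. x e *\<^sub>R e) $ 2) = (\<Prod>e\<in>Basis. F e (x e))" for x :: "real^2 \<Rightarrow> real"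
    using ne by (simp add: B F_def axis_def)
  have "has_bochner_integral (distr (\<Pi>\<^sub>M b\<in>Basis. lborel) borel (\<lambda>f. \<Sum>b\<in>Basis. f b *\<^sub>R b))
      (\<lambda>v::real^2. f (v $ 1) * g (v $ 2)) (a * b)"
    using I L R by (simp add: has_bochner_integral_iff integrable_distr_eq integral_distr eq del: sum_component)
  then show ?thesis
    by (simp flip: lborel_eq)
qed

text \<open>Real and imaginary part of the characteristic function of the standard normal law; the
  factor \<open>sqrt (2 * pi)\<close> undoes the normalisation of the density.\<close>

lemma std_normal_char:
  "has_bochner_integral lborel (\<lambda>x. exp (- x\<^sup>2 / 2) * cos (t * x)) (sqrt (2 * pi) * exp (- t\<^sup>2 / 2))"
  "has_bochner_integral lborel (\<lambda>x. exp (- x\<^sup>2 / 2) * sin (t * x)) 0"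
proof -
  have int: "integrable lborel (\<lambda>x. std_normal_density x *\<^sub>R iexp (t * x))"
    using integrable_std_normal_moment[of 0]
    by (rule Bochner_Integration.integrable_bound) (auto simp: norm_mult)
  have "(LBINT x. std_normal_density x *\<^sub>R iexp (t * x)) = exp (- (t\<^sup>2) / 2)"
    using fun_cong[OF char_std_normal_distribution, of t]
    unfolding char_def by (subst (asm) integral_density) (auto simp: normal_density_nonneg)
  with int have hb: "has_bochner_integral lborel (\<lambda>x. std_normal_density x *\<^sub>R iexp (t * x)) (complex_of_real (exp (- (t\<^sup>2) / 2)))"
    by (simp add: has_bochner_integral_iff)
  have "has_bochner_integral lborel (\<lambda>x. sqrt (2 * pi) * Re (std_normal_density x *\<^sub>R iexp (t * x)))
     (sqrt (2 * pi) * exp (- (t\<^sup>2) / 2))"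
    using has_bochner_integral_bounded_linear[OF bounded_linear_Re hb]
    by (intro has_bochner_integral_mult_right) auto
  then show "has_bochner_integral lborel (\<lambda>x. exp (- x\<^sup>2 / 2) * cos (t * x)) (sqrt (2 * pi) * exp (- t\<^sup>2 / 2))"
    by (simp add: std_normal_density_def Re_exp)
  have "has_bochner_integral lborel (\<lambda>x. sqrt (2 * pi) * Im (std_normal_density x *\<^sub>R iexp (t * x))) (sqrt (2 * pi) * 0)"
    using has_bochner_integral_bounded_linear[OF bounded_linear_Im hb]
    by (intro has_bochner_integral_mult_right) auto
  then show "has_bochner_integral lborel (\<lambda>x. exp (- x\<^sup>2 / 2) * sin (t * x)) 0"
    by (simp add: std_normal_density_def Im_exp)
qed

lemma gaussian_fourier:
  assumes s: "s > 0"
  shows "has_bochner_integral lborel (\<lambda>x. exp (- (s * x)\<^sup>2 / 2) * cos (t * x))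
      (sqrt (2 * pi) / s * exp (- (t / s)\<^sup>2 / 2))"
    "has_bochner_integral lborel (\<lambda>x. exp (- (s * x)\<^sup>2 / 2) * sin (t * x)) 0"
proof -
  have e: "t / s * (0 + s * x) = t * x" "(0 + s * x)\<^sup>2 = (s * x)\<^sup>2" for x
    using s by auto
  have a: "(sqrt (2 * pi) * exp (- (t / s)\<^sup>2 / 2)) /\<^sub>R \<bar>s\<bar> = sqrt (2 * pi) / s * exp (- (t / s)\<^sup>2 / 2)"
    "0 /\<^sub>R \<bar>s\<bar> = (0::real)"
    using s by (simp_all add: field_simps)
  have s0: "s \<noteq> 0"
    using s by simp
  show "has_bochner_integral lborel (\<lambda>x. exp (- (s * x)\<^sup>2 / 2) * cos (t * x))
      (sqrt (2 * pi) / s * exp (- (t / s)\<^sup>2 / 2))"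
    using iffD1[OF lborel_has_bochner_integral_real_affine_iff[OF s0, of _ _ 0] std_normal_char(1)[of "t / s"]]
    unfolding e a .
  show "has_bochner_integral lborel (\<lambda>x. exp (- (s * x)\<^sup>2 / 2) * sin (t * x)) 0"
    using iffD1[OF lborel_has_bochner_integral_real_affine_iff[OF s0, of _ _ 0] std_normal_char(2)[of "t / s"]]
    unfolding e a .
qed

text \<open>Writing each exponential as cosine plus sine times its unit leaves the constants
  \<open>q\<close>, \<open>qi * q\<close>, \<open>q * qj\<close> and \<open>qi * q * qj\<close>,
  each with a real weight that splits into coordinates. The three weights containing a sine
  integrate to zero, so only a real multiple of \<open>q\<close> survives and nothing has to
  commute.\<close>

lemma gaussian_quat_fourier:
  assumes s: "s > 0"
  shows "has_bochner_integral lborel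
     (\<lambda>v::real^2. exp (- (s * norm v)\<^sup>2 / 2) *\<^sub>R
        (exp ((t $ 1 * v $ 1) *\<^sub>R qi) * q * exp ((t $ 2 * v $ 2) *\<^sub>R qj)))
     ((2 * pi / s\<^sup>2 * exp (- (norm (t::real^2) / s)\<^sup>2 / 2)) *\<^sub>R q)"
proof -
  define C where "C i v = exp (- (s * v)\<^sup>2 / 2) * cos (t $ i * v)" for i v
  define S where "S i v = exp (- (s * v)\<^sup>2 / 2) * sin (t $ i * v)" for i v
  define G where "G i = sqrt (2 * pi) / s * exp (- (t $ i / s)\<^sup>2 / 2)" for i
  have C: "has_bochner_integral lborel (C i) (G i)" and S: "has_bochner_integral lborel (S i) 0" for i
    using gaussian_fourier[OF s, of "t $ i"] by (simp_all add: C_def[abs_def] S_def[abs_def] G_def)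
  have "has_bochner_integral lborel (\<lambda>v::real^2. (C 1 (v $ 1) * C 2 (v $ 2)) *\<^sub>R q
      + (S 1 (v $ 1) * C 2 (v $ 2)) *\<^sub>R (qi * q) + (C 1 (v $ 1) * S 2 (v $ 2)) *\<^sub>R (q * qj)
      + (S 1 (v $ 1) * S 2 (v $ 2)) *\<^sub>R (qi * q * qj))
    ((G 1 * G 2) *\<^sub>R q + (0 * G 2) *\<^sub>R (qi * q) + (G 1 * 0) *\<^sub>R (q * qj) + (0 * 0) *\<^sub>R (qi * q * qj))"
    by (intro has_bochner_integral_add has_bochner_integral_scaleR_left has_bochner_integral_lborel_prod2 C S)
  moreover have "exp (- (s * norm v)\<^sup>2 / 2) = exp (- (s * v $ 1)\<^sup>2 / 2) * exp (- (s * v $ 2)\<^sup>2 / 2)" for v :: "real^2"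
    by (simp add: norm_vec_def L2_set_def sum_2 power_mult_distrib distrib_left add_divide_distrib flip: exp_add)
  moreover have "G 1 * G 2 = 2 * pi / s\<^sup>2 * exp (- (norm t / s)\<^sup>2 / 2)"
  proof -
    have "exp (- (norm t / s)\<^sup>2 / 2) = exp (- (t $ 1 / s)\<^sup>2 / 2) * exp (- (t $ 2 / s)\<^sup>2 / 2)"
      by (simp add: norm_vec_def L2_set_def sum_2 power_divide add_divide_distrib flip: exp_add)
    moreover have "sqrt (2 * pi) / s * (sqrt (2 * pi) / s) = 2 * pi / s\<^sup>2"
      by (simp add: power2_eq_square)
    ultimately show ?thesis
      by (simp add: G_def)
  qed
  moreover have "(C 1 (v $ 1) * C 2 (v $ 2)) *\<^sub>R q
      + (S 1 (v $ 1) * C 2 (v $ 2)) *\<^sub>R (qi * q) + (C 1 (v $ 1) * S 2 (v $ 2)) *\<^sub>R (q * qj)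
      + (S 1 (v $ 1) * S 2 (v $ 2)) *\<^sub>R (qi * q * qj)
      = (exp (- (s * v $ 1)\<^sup>2 / 2) * exp (- (s * v $ 2)\<^sup>2 / 2)) *\<^sub>R
        (exp ((t $ 1 * v $ 1) *\<^sub>R qi) * q * exp ((t $ 2 * v $ 2) *\<^sub>R qj))" for v :: "real^2"
    by (simp add: C_def S_def exp_imaginary_unit algebra_simps)
  ultimately show ?thesis
    by simp
qed

section \<open>Continuity of translations in the mean square\<close>

lemma nn_integral_lborel_translation:
  fixes t :: "'a::euclidean_space"
  assumes [measurable]: "F \<in> borel_measurable borel"
  shows "(\<integral>\<^sup>+x. F (x + t) \<partial>lborel) = (\<integral>\<^sup>+x. F x \<partial>lborel)"
proof -
  have "(\<integral>\<^sup>+x. F x \<partial>lborel) = (\<integral>\<^sup>+x. F x \<partial>distr lborel borel ((+) t))"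
    by (simp add: lborel_distr_plus)
  also have "\<dots> = (\<integral>\<^sup>+x. F (x + t) \<partial>lborel)"
    by (subst nn_integral_distr) (simp_all add: add.commute)
  finally show ?thesis ..
qed

lemma norm_sum3_squared_le:
  fixes a b c :: "'a::real_normed_vector"
  shows "(norm (a + b + c))\<^sup>2 \<le> 3 * (norm a)\<^sup>2 + 3 * (norm b)\<^sup>2 + 3 * (norm c)\<^sup>2"
proof -
  have "(norm (a + b + c))\<^sup>2 \<le> (norm a + norm b + norm c)\<^sup>2"
    by (intro power_mono) (auto intro: norm_triangle_le add_mono norm_triangle_ineq)
  also have "\<dots> \<le> 3 * (norm a)\<^sup>2 + 3 * (norm b)\<^sup>2 + 3 * (norm c)\<^sup>2"
    using sum_squares_ge_zero[of "norm a - norm b" "norm a - norm c"] zero_le_power2[of "norm b - norm c"]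
    by (simp add: power2_eq_square algebra_simps)
  finally show ?thesis .
qed

text \<open>Translation preserves the mean-square norm, so the distance of \<open>f\<close> from
  \<open>g k\<close> is the same before and after translation and can be made small independently of
  \<open>n\<close>.\<close>

lemma L2_translation_limit_closed:
  fixes f :: "'a::euclidean_space \<Rightarrow> 'b::euclidean_space" and g :: "nat \<Rightarrow> 'a \<Rightarrow> 'b"
  assumes [measurable]: "f \<in> borel_measurable borel" "\<And>k. g k \<in> borel_measurable borel"
    and gf: "(\<lambda>k. \<integral>\<^sup>+x. (norm (g k x - f x))\<^sup>2 \<partial>lborel) \<longlonglongrightarrow> 0"
    and g: "\<And>k. (\<lambda>n. \<integral>\<^sup>+x. (norm (g k (x + t n) - g k x))\<^sup>2 \<partial>lborel) \<longlonglongrightarrow> 0"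
  shows "(\<lambda>n. \<integral>\<^sup>+x. (norm (f (x + t n) - f x))\<^sup>2 \<partial>lborel) \<longlonglongrightarrow> 0"
proof (rule order_tendstoI)
  fix a :: ennreal assume "0 < a"
  then obtain r where r: "0 < ennreal r" "ennreal r < a"
    by (metis dense ennreal_cases less_top_ennreal order_less_trans order_less_le_trans top.extremum)
  then have r0: "0 < r" by simp
  \<comment> \<open>With the factor 3 of \<open>norm_sum3_squared_le\<close>, the thresholds
    \<open>r / 12\<close>, \<open>r / 6\<close>, \<open>r / 12\<close> become \<open>r / 4\<close>,
    \<open>r / 2\<close>, \<open>r / 4\<close> and add up to \<open>r\<close>.\<close>
  obtain k where k: "(\<integral>\<^sup>+x. (norm (g k x - f x))\<^sup>2 \<partial>lborel) < ennreal (r / 12)"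
    using order_tendstoD(2)[OF gf, of "ennreal (r / 12)"] r0 by (auto simp: eventually_sequentially)
  have "\<forall>\<^sub>F n in sequentially. (\<integral>\<^sup>+x. (norm (g k (x + t n) - g k x))\<^sup>2 \<partial>lborel) < ennreal (r / 6)"
    using order_tendstoD(2)[OF g, of "ennreal (r / 6)"] r0 by auto
  then show "\<forall>\<^sub>F n in sequentially. (\<integral>\<^sup>+x. (norm (f (x + t n) - f x))\<^sup>2 \<partial>lborel) < a"
  proof eventually_elim
    fix n assume n: "(\<integral>\<^sup>+x. (norm (g k (x + t n) - g k x))\<^sup>2 \<partial>lborel) < ennreal (r / 6)"
    have "(\<integral>\<^sup>+x. (norm (f (x + t n) - f x))\<^sup>2 \<partial>lborel) \<le>
      (\<integral>\<^sup>+x. 3 * ennreal ((norm (g k (x + t n) - f (x + t n)))\<^sup>2) + 3 * ennreal ((norm (g k (x + t n) - g k x))\<^sup>2)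
        + 3 * ennreal ((norm (g k x - f x))\<^sup>2) \<partial>lborel)"
    proof (rule nn_integral_mono)
      fix x
      have "(norm (f (x + t n) - f x))\<^sup>2 \<le> 3 * (norm (g k (x + t n) - f (x + t n)))\<^sup>2
          + 3 * (norm (g k (x + t n) - g k x))\<^sup>2 + 3 * (norm (g k x - f x))\<^sup>2"
        using norm_sum3_squared_le[of "f (x + t n) - g k (x + t n)" "g k (x + t n) - g k x" "g k x - f x"]
        by (simp add: norm_minus_commute)
      then show "ennreal ((norm (f (x + t n) - f x))\<^sup>2) \<le> 3 * ennreal ((norm (g k (x + t n) - f (x + t n)))\<^sup>2)
          + 3 * ennreal ((norm (g k (x + t n) - g k x))\<^sup>2) + 3 * ennreal ((norm (g k x - f x))\<^sup>2)"
        by (simp add: ennreal_leI flip: ennreal_plus ennreal_mult' ennreal_numeral)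
    qed
    also have "\<dots> = 3 * (\<integral>\<^sup>+x. (norm (g k (x + t n) - f (x + t n)))\<^sup>2 \<partial>lborel)
        + 3 * (\<integral>\<^sup>+x. (norm (g k (x + t n) - g k x))\<^sup>2 \<partial>lborel) + 3 * (\<integral>\<^sup>+x. (norm (g k x - f x))\<^sup>2 \<partial>lborel)"
      by (subst nn_integral_add nn_integral_cmult; measurable)+
    also have "(\<integral>\<^sup>+x. (norm (g k (x + t n) - f (x + t n)))\<^sup>2 \<partial>lborel) = (\<integral>\<^sup>+x. (norm (g k x - f x))\<^sup>2 \<partial>lborel)"
      by (rule nn_integral_lborel_translation[where F="\<lambda>x. ennreal ((norm (g k x - f x))\<^sup>2)"]) measurable
    also have "3 * (\<integral>\<^sup>+x. (norm (g k x - f x))\<^sup>2 \<partial>lborel) + 3 * (\<integral>\<^sup>+x. (norm (g k (x + t n) - g k x))\<^sup>2 \<partial>lborel)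
        + 3 * (\<integral>\<^sup>+x. (norm (g k x - f x))\<^sup>2 \<partial>lborel) \<le> 3 * ennreal (r / 12) + 3 * ennreal (r / 6) + 3 * ennreal (r / 12)"
      using k n by (intro add_mono mult_left_mono) auto
    also have "\<dots> = ennreal r"
      using r0 by (simp flip: ennreal_plus ennreal_mult' ennreal_numeral)
    finally show "(\<integral>\<^sup>+x. (norm (f (x + t n) - f x))\<^sup>2 \<partial>lborel) < a"
      using r by simp
  qed
qed simp

text \<open>Continuity gives pointwise convergence. The convergent sequence \<open>t\<close> is
  bounded, so all the differences live in one ball, on which a constant dominates them.\<close>

lemma L2_translation_continuous_compact_support:
  fixes g :: "'a::euclidean_space \<Rightarrow> 'b::euclidean_space"
  assumes g: "continuous_on UNIV g" and B: "\<And>x. norm (g x) \<le> B" and R: "\<And>x. norm x > R \<Longrightarrow> g x = 0"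
    and t: "t \<longlonglongrightarrow> 0"
  shows "(\<lambda>n. \<integral>\<^sup>+x. (norm (g (x + t n) - g x))\<^sup>2 \<partial>lborel) \<longlonglongrightarrow> 0"
proof -
  have [measurable]: "g \<in> borel_measurable borel"
    using g by (rule borel_measurable_continuous_onI)
  obtain T where T: "\<And>n. norm (t n) \<le> T"
    using convergent_imp_Bseq[of t] t by (auto simp: convergent_def Bseq_def)
  have T0: "0 \<le> T"
    using T[of 0] norm_ge_zero order_trans by blast
  define w where "w x = ennreal ((B + B)\<^sup>2) * indicator (cball 0 (R + T)) x" for x :: 'a
  have "(\<lambda>n. \<integral>\<^sup>+x. (norm (g (x + t n) - g x))\<^sup>2 \<partial>lborel) \<longlonglongrightarrow> nn_integral (lborel :: 'a measure) (\<lambda>_. 0)"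
  proof (rule nn_integral_dominated_convergence[where w=w])
    have "(\<integral>\<^sup>+x. w x \<partial>lborel) = ennreal ((B + B)\<^sup>2) * emeasure lborel (cball (0::'a) (R + T))"
      unfolding w_def by (subst nn_integral_cmult) (auto intro!: borel_measurable_indicator)
    then show "(\<integral>\<^sup>+x. w x \<partial>lborel) < \<infinity>"
      using emeasure_lborel_cball_finite[of "0::'a" "R + T"] by (simp add: ennreal_mult_less_top)
    show "AE x in lborel. ennreal ((norm (g (x + t n) - g x))\<^sup>2) \<le> w x" for n
    proof (intro AE_I2)
      fix x
      show "ennreal ((norm (g (x + t n) - g x))\<^sup>2) \<le> w x"
      proof (cases "norm x \<le> R + T")
        case True
        have "norm (g (x + t n) - g x) \<le> B + B"
          by (intro order_trans[OF norm_triangle_ineq4] add_mono B)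
        then have "(norm (g (x + t n) - g x))\<^sup>2 \<le> (B + B)\<^sup>2"
          by (intro power_mono) auto
        with True show ?thesis
          by (simp add: w_def ennreal_leI)
      next
        case False
        then have "norm x > R" "norm (x + t n) > R"
          using T[of n] T0 norm_triangle_ineq4[of "x + t n" "t n"] by auto
        then show ?thesis
          by (simp add: R)
      qed
    qed
    show "AE x in lborel. (\<lambda>n. ennreal ((norm (g (x + t n) - g x))\<^sup>2)) \<longlonglongrightarrow> 0"
    proof (intro AE_I2)
      fix x
      have "(\<lambda>n. g (x + t n)) \<longlonglongrightarrow> g (x + 0)"
        using g by (intro continuous_on_tendsto_compose[OF g] tendsto_intros t) auto
      then have "(\<lambda>n. (norm (g (x + t n) - g x))\<^sup>2) \<longlonglongrightarrow> (norm (g (x + 0) - g x))\<^sup>2"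
        by (intro tendsto_intros)
      then show "(\<lambda>n. ennreal ((norm (g (x + t n) - g x))\<^sup>2)) \<longlonglongrightarrow> 0"
        using tendsto_ennrealI by fastforce
    qed
  qed (auto simp: w_def[abs_def] intro!: borel_measurable_times_ennreal borel_measurable_indicator)
  then show ?thesis by simp
qed

text \<open>Two nested approximations: \<open>f\<close> by its cut-offs \<open>fR k\<close>, and
  each cut-off, for fixed \<open>k\<close>, by continuous functions of bounded support. The latter
  are cut-offs of continuous functions that converge to \<open>f\<close> almost everywhere.\<close>

lemma L2_translation_continuous:
  fixes f :: "'a::euclidean_space \<Rightarrow> 'b::euclidean_space"
  assumes f [measurable]: "f \<in> borel_measurable borel"
    and L2: "(\<integral>\<^sup>+x. (norm (f x))\<^sup>2 \<partial>lborel) < \<infinity>"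
    and t: "t \<longlonglongrightarrow> 0"
  shows "(\<lambda>n. \<integral>\<^sup>+x. (norm (f (x + t n) - f x))\<^sup>2 \<partial>lborel) \<longlonglongrightarrow> 0"
proof -
  \<comment> \<open>The first factor is a continuous bump in \<open>x\<close> that vanishes outside
    the ball of radius \<open>R\<close>; the second pulls \<open>q\<close> back to norm at most
    \<open>R\<close>. As \<open>cut\<close> is continuous in both arguments, it respects pointwise
    limits, and its bounds supply the dominating functions.\<close>
  define cut :: "real \<Rightarrow> 'a \<Rightarrow> 'b \<Rightarrow> 'b" where
    "cut R x q = (max 0 (min 1 (R - norm x)) * (R / max R (norm q))) *\<^sub>R q" for R x q
  have cut_le: "norm (cut R x q) \<le> norm q" if "R > 0" for R x q
  proof -
    have "\<bar>max 0 (min 1 (R - norm x)) * (R / max R (norm q))\<bar> \<le> 1 * 1"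
      unfolding abs_mult using that by (intro mult_mono) (auto simp: field_simps)
    then show ?thesis
      unfolding cut_def norm_scaleR by (metis mult_left_le_one_le mult_1 norm_ge_zero abs_ge_zero)
  qed
  have cut_le': "norm (cut R x q) \<le> R" if "R > 0" for R x q
  proof -
    have "norm (cut R x q) = \<bar>max 0 (min 1 (R - norm x))\<bar> * (R / max R (norm q) * norm q)"
      using that by (simp add: cut_def abs_mult)
    also have "\<dots> \<le> 1 * R"
      using that by (intro mult_mono) (auto simp: field_simps)
    finally show ?thesis by simp
  qed
  have cut0: "cut R x q = 0" if "norm x > R" for R x q
    using that by (simp add: cut_def)
  have cut_cont: "continuous_on UNIV (\<lambda>x. cut R x (g x))" if "continuous_on UNIV g" "R > 0" for R g
    unfolding cut_def using that by (intro continuous_intros) auto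
  have cut_lim: "(\<lambda>n. cut R x (g n)) \<longlonglongrightarrow> cut R x q" if "g \<longlonglongrightarrow> q" "R > 0" for R x g q
    unfolding cut_def using that by (intro tendsto_intros) auto
  have cut_meas [measurable]: "(\<lambda>x. cut R x (g x)) \<in> borel_measurable borel"
    if [measurable]: "g \<in> borel_measurable borel" for R g
    unfolding cut_def by measurable
  define fR where "fR k x = cut (real (Suc k)) x (f x)" for k :: nat and x
  have fR [measurable]: "fR k \<in> borel_measurable borel" for k
    unfolding fR_def by measurable
  have "(\<lambda>k. \<integral>\<^sup>+x. (norm (fR k x - f x))\<^sup>2 \<partial>lborel) \<longlonglongrightarrow> nn_integral (lborel :: 'a measure) (\<lambda>_. 0)"
  proof (rule nn_integral_dominated_convergence[where w="\<lambda>x. 4 * ennreal ((norm (f x))\<^sup>2)"])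
    show "(\<integral>\<^sup>+x. 4 * ennreal ((norm (f x))\<^sup>2) \<partial>lborel) < \<infinity>"
      using L2 by (subst nn_integral_cmult) (auto simp: ennreal_mult_less_top)
    show "AE x in lborel. ennreal ((norm (fR k x - f x))\<^sup>2) \<le> 4 * ennreal ((norm (f x))\<^sup>2)" for k
    proof (intro AE_I2)
      fix x
      have "norm (fR k x - f x) \<le> norm (f x) + norm (f x)"
        unfolding fR_def by (intro order_trans[OF norm_triangle_ineq4] add_mono cut_le) auto
      then have "(norm (fR k x - f x))\<^sup>2 \<le> (2 * norm (f x))\<^sup>2"
        by (intro power_mono) auto
      then show "ennreal ((norm (fR k x - f x))\<^sup>2) \<le> 4 * ennreal ((norm (f x))\<^sup>2)"
        by (simp add: power_mult_distrib ennreal_leI flip: ennreal_mult' ennreal_numeral)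
    qed
    show "AE x in lborel. (\<lambda>k. ennreal ((norm (fR k x - f x))\<^sup>2)) \<longlonglongrightarrow> 0"
    proof (intro AE_I2)
      fix x
      \<comment> \<open>From this index on both factors of the cut-off equal 1: the bump because
        \<open>norm x + 1\<close> is at most the radius, the second factor because
        \<open>norm (f x)\<close> is.\<close>
      obtain N :: nat where N: "norm x + 1 + norm (f x) \<le> N"
        using real_arch_simple by blast
      have "fR k x = f x" if "k \<ge> N" for k
      proof -
        have "norm x + 1 + norm (f x) \<le> real k"
          using N that by linarith
        then have "min 1 (1 + real k - norm x) = 1" "max (1 + real k) (norm (f x)) = 1 + real k"
          using norm_ge_zero[of x] norm_ge_zero[of "f x"] by linarith+
        then show ?thesis
          by (simp add: fR_def cut_def)
      qed
      then show "(\<lambda>k. ennreal ((norm (fR k x - f x))\<^sup>2)) \<longlonglongrightarrow> 0"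
        by (intro tendsto_eventually) (auto simp: eventually_sequentially)
    qed
  qed auto
  then have 1: "(\<lambda>k. \<integral>\<^sup>+x. (norm (fR k x - f x))\<^sup>2 \<partial>lborel) \<longlonglongrightarrow> 0"
    by simp
  have "f measurable_on UNIV"
    using measurable_completion[of f lborel borel] by (simp add: measurable_on_iff_borel_measurable lebesgue_on_UNIV_eq)
  then obtain N g where N: "negligible N" and g: "\<And>n. continuous_on UNIV (g n)"
    and lim: "\<And>x. x \<notin> N \<Longrightarrow> (\<lambda>n. g n x) \<longlonglongrightarrow> f x"
    by (auto simp: measurable_on_def)
  have [measurable]: "g n \<in> borel_measurable borel" for n
    using g by (rule borel_measurable_continuous_onI)
  have AEN: "AE x in lborel. x \<notin> N"
    using AE_not_in[of N lebesgue] N by (simp add: negligible_iff_null_sets AE_completion_iff)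
  have 2: "(\<lambda>n. \<integral>\<^sup>+x. (norm (fR k (x + t n) - fR k x))\<^sup>2 \<partial>lborel) \<longlonglongrightarrow> 0" for k
  proof (rule L2_translation_limit_closed)
    define R where "R = real (Suc k)"
    have R: "R > 0" by (simp add: R_def)
    define w where "w x = ennreal ((R + R)\<^sup>2) * indicator (cball 0 R) x" for x :: 'a
    have "(\<lambda>n. \<integral>\<^sup>+x. (norm (cut R x (g n x) - fR k x))\<^sup>2 \<partial>lborel) \<longlonglongrightarrow> nn_integral (lborel :: 'a measure) (\<lambda>_. 0)"
    proof (rule nn_integral_dominated_convergence[where w=w])
      have "(\<integral>\<^sup>+x. w x \<partial>lborel) = ennreal ((R + R)\<^sup>2) * emeasure lborel (cball (0::'a) R)"
        unfolding w_def by (subst nn_integral_cmult) (auto intro!: borel_measurable_indicator)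
      then show "(\<integral>\<^sup>+x. w x \<partial>lborel) < \<infinity>"
        using emeasure_lborel_cball_finite[of "0::'a" R] by (simp add: ennreal_mult_less_top)
      show "AE x in lborel. ennreal ((norm (cut R x (g n x) - fR k x))\<^sup>2) \<le> w x" for n
      proof (intro AE_I2)
        fix x
        have "norm (cut R x (g n x) - fR k x) \<le> R + R"
          unfolding fR_def R_def[symmetric] by (intro order_trans[OF norm_triangle_ineq4] add_mono cut_le' R)
        then have "(norm (cut R x (g n x) - fR k x))\<^sup>2 \<le> (R + R)\<^sup>2"
          by (intro power_mono) auto
        moreover have "norm x > R \<Longrightarrow> cut R x (g n x) - fR k x = 0"
          unfolding fR_def R_def[symmetric] by (simp add: cut0)
        ultimately show "ennreal ((norm (cut R x (g n x) - fR k x))\<^sup>2) \<le> w x"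
          by (cases "norm x \<le> R") (simp_all add: w_def ennreal_leI)
      qed
      show "AE x in lborel. (\<lambda>n. ennreal ((norm (cut R x (g n x) - fR k x))\<^sup>2)) \<longlonglongrightarrow> 0"
        using AEN
      proof eventually_elim
        fix x assume "x \<notin> N"
        then have "(\<lambda>n. (norm (cut R x (g n x) - fR k x))\<^sup>2) \<longlonglongrightarrow> (norm (cut R x (f x) - fR k x))\<^sup>2"
          by (intro tendsto_intros cut_lim R lim)
        then show "(\<lambda>n. ennreal ((norm (cut R x (g n x) - fR k x))\<^sup>2)) \<longlonglongrightarrow> 0"
          using tendsto_ennrealI by (fastforce simp: fR_def R_def)
      qed
    qed (auto simp: w_def[abs_def] intro!: borel_measurable_times_ennreal borel_measurable_indicator)
    then show "(\<lambda>n. \<integral>\<^sup>+x. (norm (cut R x (g n x) - fR k x))\<^sup>2 \<partial>lborel) \<longlonglongrightarrow> 0"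
      by simp
    show "(\<lambda>n. \<integral>\<^sup>+x. (norm (cut R (x + t n) (g m (x + t n)) - cut R x (g m x)))\<^sup>2 \<partial>lborel) \<longlonglongrightarrow> 0" for m
      by (rule L2_translation_continuous_compact_support[where B=R and R=R])
        (auto intro: cut_cont g R cut_le' cut0 t)
  qed auto
  show ?thesis
    by (rule L2_translation_limit_closed[OF _ _ 1 2]) auto
qed

section \<open>Plancherel for the two-sided Fourier transform\<close>

lemma measurable_vec_nth [measurable]: "(\<lambda>x::real^'n. x $ i) \<in> borel_measurable borel"
  by (intro borel_measurable_continuous_onI continuous_intros)

lemma (in pair_sigma_finite) integrable_mult_pair:
  fixes f g :: "_ \<Rightarrow> real"
  assumes f: "integrable M1 f" and g: "integrable M2 g"
  shows "integrable (M1 \<Otimes>\<^sub>M M2) (\<lambda>(x, y). f x * g y)"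
proof -
  have [measurable]: "f \<in> borel_measurable M1" "g \<in> borel_measurable M2"
    using f g by auto
  show ?thesis
    by (rule Fubini_integrable) (use f g in \<open>auto simp: abs_mult\<close>)
qed

lemma lborel_integral_translation:
  fixes F :: "'a::euclidean_space \<Rightarrow> 'b::euclidean_space"
  assumes [measurable]: "F \<in> borel_measurable borel"
  shows "(\<integral>x. F (x + t) \<partial>lborel) = (\<integral>x. F x \<partial>lborel)"
    "integrable lborel (\<lambda>x. F (x + t)) \<longleftrightarrow> integrable lborel F"
proof -
  have "(\<integral>x. F x \<partial>lborel) = (\<integral>x. F x \<partial>distr lborel borel ((+) t))"
    by (simp add: lborel_distr_plus)
  also have "\<dots> = (\<integral>x. F (x + t) \<partial>lborel)"
    by (subst integral_distr) (simp_all add: add.commute)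
  finally show "(\<integral>x. F (x + t) \<partial>lborel) = (\<integral>x. F x \<partial>lborel)" ..
  have "integrable lborel F \<longleftrightarrow> integrable (distr lborel borel ((+) t)) F"
    by (simp add: lborel_distr_plus)
  also have "\<dots> \<longleftrightarrow> integrable lborel (\<lambda>x. F (x + t))"
    by (subst integrable_distr_eq) (simp_all add: add.commute)
  finally show "integrable lborel (\<lambda>x. F (x + t)) \<longleftrightarrow> integrable lborel F" ..
qed

section \<open>Autocorrelation and its continuity at the origin\<close>

definition autocorrelation :: "('a::euclidean_space \<Rightarrow> 'b::euclidean_space) \<Rightarrow> 'a \<Rightarrow> real" where
  "autocorrelation g t = (\<integral>x. inner (g (x + t)) (g x) \<partial>lborel)"

text \<open>Expanding the square of \<open>g (x + t) - g x\<close> isolates the mixed term.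
  Continuity of the autocorrelation at the origin thereby reduces to mean-square continuity of
  translations; the uniform bound dominates the limit passage in the Plancherel theorem.\<close>

lemma autocorrelation:
  fixes g :: "'a::euclidean_space \<Rightarrow> 'b::euclidean_space"
  assumes [measurable]: "g \<in> borel_measurable borel" and L2: "integrable lborel (\<lambda>x. (norm (g x))\<^sup>2)"
  shows autocorrelation_eq: "autocorrelation g t =
      (\<integral>x. (norm (g x))\<^sup>2 \<partial>lborel) - (\<integral>x. (norm (g (x + t) - g x))\<^sup>2 \<partial>lborel) / 2"
    and abs_autocorrelation_le: "\<bar>autocorrelation g t\<bar> \<le> (\<integral>x. (norm (g x))\<^sup>2 \<partial>lborel)"
proof -
  have L2t: "integrable lborel (\<lambda>x. (norm (g (x + t)))\<^sup>2)"
    and Et: "(\<integral>x. (norm (g (x + t)))\<^sup>2 \<partial>lborel) = (\<integral>x. (norm (g x))\<^sup>2 \<partial>lborel)"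
    using L2 lborel_integral_translation[of "\<lambda>x. (norm (g x))\<^sup>2" t] by auto
  have le: "\<bar>inner (g (x + t)) (g x)\<bar> \<le> ((norm (g (x + t)))\<^sup>2 + (norm (g x))\<^sup>2) / 2" for x
    using Cauchy_Schwarz_ineq2[of "g (x + t)" "g x"] sum_squares_bound[of "norm (g (x + t))" "norm (g x)"]
    by simp
  have int: "integrable lborel (\<lambda>x. inner (g (x + t)) (g x))"
    by (rule Bochner_Integration.integrable_bound[where f="\<lambda>x. ((norm (g (x + t)))\<^sup>2 + (norm (g x))\<^sup>2) / 2"])
      (use le L2 L2t in \<open>auto\<close>)
  have "(\<integral>x. (norm (g (x + t) - g x))\<^sup>2 \<partial>lborel)
      = (\<integral>x. (norm (g (x + t)))\<^sup>2 + (norm (g x))\<^sup>2 - 2 * inner (g (x + t)) (g x) \<partial>lborel)"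
    by (intro Bochner_Integration.integral_cong) (auto simp: power2_norm_eq_inner inner_diff inner_commute)
  also have "\<dots> = 2 * (\<integral>x. (norm (g x))\<^sup>2 \<partial>lborel) - 2 * autocorrelation g t"
    using L2 L2t int Et by (simp add: autocorrelation_def)
  finally show "autocorrelation g t =
      (\<integral>x. (norm (g x))\<^sup>2 \<partial>lborel) - (\<integral>x. (norm (g (x + t) - g x))\<^sup>2 \<partial>lborel) / 2"
    by (simp add: field_simps)
  have "\<bar>autocorrelation g t\<bar> \<le> (\<integral>x. \<bar>inner (g (x + t)) (g x)\<bar> \<partial>lborel)"
    unfolding autocorrelation_def by (rule integral_abs_bound)
  also have "\<dots> \<le> (\<integral>x. ((norm (g (x + t)))\<^sup>2 + (norm (g x))\<^sup>2) / 2 \<partial>lborel)"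
    using int L2 L2t le by (intro integral_mono) auto
  also have "\<dots> = (\<integral>x. (norm (g x))\<^sup>2 \<partial>lborel)"
    using L2 L2t Et by simp
  finally show "\<bar>autocorrelation g t\<bar> \<le> (\<integral>x. (norm (g x))\<^sup>2 \<partial>lborel)" .
qed

lemma autocorrelation_tendsto:
  fixes g :: "'a::euclidean_space \<Rightarrow> 'b::euclidean_space"
  assumes [measurable]: "g \<in> borel_measurable borel" and L2: "integrable lborel (\<lambda>x. (norm (g x))\<^sup>2)"
    and t: "t \<longlonglongrightarrow> 0"
  shows "(\<lambda>n. autocorrelation g (t n)) \<longlonglongrightarrow> (\<integral>x. (norm (g x))\<^sup>2 \<partial>lborel)"
proof -
  have "(\<integral>\<^sup>+x. (norm (g x))\<^sup>2 \<partial>lborel) < \<infinity>"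
    using L2 by (simp add: integrable_iff_bounded)
  from L2_translation_continuous[OF assms(1) this t]
  have "(\<lambda>n. enn2real (\<integral>\<^sup>+x. (norm (g (x + t n) - g x))\<^sup>2 \<partial>lborel)) \<longlonglongrightarrow> enn2real 0"
    by (intro tendsto_enn2real) auto
  then have "(\<lambda>n. \<integral>x. (norm (g (x + t n) - g x))\<^sup>2 \<partial>lborel) \<longlonglongrightarrow> 0"
    by (simp add: integral_eq_nn_integral)
  then have "(\<lambda>n. (\<integral>x. (norm (g x))\<^sup>2 \<partial>lborel) - (\<integral>x. (norm (g (x + t n) - g x))\<^sup>2 \<partial>lborel) / 2)
      \<longlonglongrightarrow> (\<integral>x. (norm (g x))\<^sup>2 \<partial>lborel) - 0 / 2"
    by (intro tendsto_intros) auto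
  then show ?thesis
    by (simp add: autocorrelation_eq[OF assms(1,2)])
qed

section \<open>From the Gaussian-weighted to the plain Plancherel identity\<close>

definition qft :: "(real^2 \<Rightarrow> quat) \<Rightarrow> real^2 \<Rightarrow> quat" where
  "qft g v = (\<integral>x. exp ((- (x $ 1 * v $ 1)) *\<^sub>R qi) * g x * exp ((- (x $ 2 * v $ 2)) *\<^sub>R qj) \<partial>lborel)"

lemma gaussian_integrable:
  assumes "s > 0"
  shows "integrable lborel (\<lambda>v::real^2. exp (- (s * norm v)\<^sup>2 / 2))"
    and "(LBINT v::real^2. exp (- (s * norm v)\<^sup>2 / 2)) = 2 * pi / s\<^sup>2"
proof -
  have inner_one: "inner (1::quat) 1 = 1"
    by (simp add: inner_quat_def one_quat_def)
  have "has_bochner_integral lborel (\<lambda>v::real^2. exp (- (s * norm v)\<^sup>2 / 2)) (2 * pi / s\<^sup>2)"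
    using has_bochner_integral_inner_left[OF gaussian_quat_fourier[OF assms, of 0 1], of 1] inner_one
    by simp
  then show "integrable lborel (\<lambda>v::real^2. exp (- (s * norm v)\<^sup>2 / 2))"
    and "(LBINT v::real^2. exp (- (s * norm v)\<^sup>2 / 2)) = 2 * pi / s\<^sup>2"
    by (simp_all add: has_bochner_integral_iff)
qed

lemma qcnj_mult_unit:
  assumes "norm a = 1" shows "qcnj a * a = 1" "a * qcnj a = 1"
  using assms modulus_quat[of a] modulus_quat[of "qcnj a"] by simp_all

lemma norm_rot [simp]: "norm (exp (r *\<^sub>R qi)) = 1" "norm (exp (r *\<^sub>R qj)) = 1"
    "norm (exp (- (r *\<^sub>R qi))) = 1" "norm (exp (- (r *\<^sub>R qj))) = 1"
  using norm_exp_imaginary_unit[of qi r] norm_exp_imaginary_unit[of qj r]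
    norm_exp_imaginary_unit[of qi "- r"] norm_exp_imaginary_unit[of qj "- r"] by simp_all

text \<open>In the integrand at \<open>y + t\<close> the exponentials in \<open>y\<close> stand
  outermost, powers of \<open>qi\<close> on the left and of \<open>qj\<close> on the right.
  \<open>inner_qmult\<close> moves them across the real inner product, where they cancel against
  those of the integrand at \<open>y\<close>, so the frequency enters only through
  \<open>t\<close>.\<close>

lemma norm_qft_squared:
  assumes [measurable]: "g \<in> borel_measurable borel" and g: "integrable lborel g"
  shows "(norm (qft g v))\<^sup>2 = (\<integral>y. \<integral>t. inner (exp ((- (t $ 1 * v $ 1)) *\<^sub>R qi) * g (y + t) *
      exp ((- (t $ 2 * v $ 2)) *\<^sub>R qj)) (g y) \<partial>lborel \<partial>lborel)"
proof -
  define k where "k x = exp ((- (x $ 1 * v $ 1)) *\<^sub>R qi) * g x * exp ((- (x $ 2 * v $ 2)) *\<^sub>R qj)" for x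
  have [measurable]: "k \<in> borel_measurable borel"
    unfolding k_def by measurable
  have k: "integrable lborel k"
    by (rule Bochner_Integration.integrable_bound[OF g]) (auto simp: k_def norm_mult)
  have "(norm (qft g v))\<^sup>2 = inner (\<integral>x. k x \<partial>lborel) (\<integral>y. k y \<partial>lborel)"
    by (simp add: power2_norm_eq_inner qft_def k_def)
  also have "\<dots> = (\<integral>y. inner (\<integral>x. k x \<partial>lborel) (k y) \<partial>lborel)"
    using k by (intro integral_inner_right[symmetric]) auto
  also have "\<dots> = (\<integral>y. \<integral>x. inner (k x) (k y) \<partial>lborel \<partial>lborel)"
    using k by (simp)
  also have "\<dots> = (\<integral>y. \<integral>t. inner (k (t + y)) (k y) \<partial>lborel \<partial>lborel)"
    by (subst lborel_integral_translation(1)[symmetric, of "\<lambda>x. inner (k x) (k y)" y for y]) auto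
  also have "\<dots> = (\<integral>y. \<integral>t. inner (exp ((- (t $ 1 * v $ 1)) *\<^sub>R qi) * g (y + t) *
      exp ((- (t $ 2 * v $ 2)) *\<^sub>R qj)) (g y) \<partial>lborel \<partial>lborel)"
  proof -
    have "inner (k (t + y)) (k y) = inner (exp ((- (t $ 1 * v $ 1)) *\<^sub>R qi) * g (y + t) *
        exp ((- (t $ 2 * v $ 2)) *\<^sub>R qj)) (g y)" for t y
    proof -
      define a b c d where "a = exp ((- (t $ 1 * v $ 1)) *\<^sub>R qi)" and "b = exp ((- (t $ 2 * v $ 2)) *\<^sub>R qj)"
        and "c = exp ((- (y $ 1 * v $ 1)) *\<^sub>R qi)" and "d = exp ((- (y $ 2 * v $ 2)) *\<^sub>R qj)"
      have "k (t + y) = (c * a) * g (y + t) * (b * d)"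
        unfolding k_def a_def b_def c_def d_def exp_scaleR_add[symmetric] by (simp add: algebra_simps)
      moreover have "k y = c * g y * d"
        by (simp add: k_def c_def d_def)
      moreover have "qcnj c * c = 1" "d * qcnj d = 1"
        by (simp_all only: c_def d_def qcnj_mult_unit norm_exp_imaginary_unit unit_qi unit_qj)
      then have "qcnj c * ((c * a) * g (y + t) * (b * d)) * qcnj d = a * g (y + t) * b"
        by (metis mult.assoc mult.left_neutral mult.right_neutral)
      ultimately have "inner (k (t + y)) (k y) = inner (a * g (y + t) * b) (g y)"
        by (metis inner_qmult inner_commute)
      then show ?thesis
        by (simp add: a_def b_def)
    qed
    then show ?thesis
      by simp
  qed
  finally show ?thesis .
qed

text \<open>The weight makes the triple integral over \<open>v\<close>, \<open>y\<close>,
  \<open>t\<close> absolutely convergent. Integrating over \<open>v\<close> first gives a Gaussian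
  in \<open>t\<close> by \<open>gaussian_quat_fourier\<close>, and the integral over
  \<open>y\<close> that remains is the autocorrelation.\<close>

lemma weighted_plancherel:
  assumes [measurable]: "g \<in> borel_measurable borel" and g: "integrable lborel g" and s: "s > 0"
  shows "has_bochner_integral lborel (\<lambda>v. exp (- (s * norm v)\<^sup>2 / 2) * (norm (qft g v))\<^sup>2)
     (LBINT t. 2 * pi / s\<^sup>2 * exp (- (norm t / s)\<^sup>2 / 2) * autocorrelation g t)"
proof -
  define W where "W v = exp (- (s * norm v)\<^sup>2 / 2)" for v :: "real^2"
  define H where "H v y t = inner (exp ((- (t $ 1 * v $ 1)) *\<^sub>R qi) * g (y + t) *
      exp ((- (t $ 2 * v $ 2)) *\<^sub>R qj)) (g y)" for v y t :: "real^2"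
  let ?M = "lborel \<Otimes>\<^sub>M lborel :: ((real^2) \<times> (real^2)) measure"
  interpret P: pair_sigma_finite "lborel :: (real^2) measure" ?M
    by (intro pair_sigma_finite.intro) (simp_all add: lborel_prod lborel.sigma_finite_measure_axioms)
  have W: "integrable lborel W" and [measurable]: "W \<in> borel_measurable borel"
    using gaussian_integrable(1)[OF s] unfolding W_def by (simp, measurable)
  have gn: "integrable lborel (\<lambda>x. norm (g x))"
    using g by simp
  \<comment> \<open>Integrability of \<open>g\<close> enters here: integrating over \<open>t\<close>
    and then over \<open>y\<close> gives the square of the integral of
    \<open>norm (g x)\<close>.\<close>
  have K: "integrable ?M (\<lambda>(y, t). norm (g (y + t)) * norm (g y))"
  proof (rule lborel_pair.Fubini_integrable)
    have "(\<integral>t. norm (g (y + t)) * norm (g y) \<partial>lborel) = (\<integral>x. norm (g x) \<partial>lborel) * norm (g y)" for y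
      using lborel_integral_translation(1)[of "\<lambda>x. norm (g x)" y] by (simp add: add.commute)
    then show "integrable lborel (\<lambda>x. \<integral>y. norm (case (x, y) of (y, t) \<Rightarrow> norm (g (y + t)) * norm (g y)) \<partial>lborel)"
      by (simp only: prod.case real_norm_def abs_mult abs_norm_cancel) (rule integrable_mult_right[OF gn])
    show "AE x in lborel. integrable lborel (\<lambda>y. case (x, y) of (y, t) \<Rightarrow> norm (g (y + t)) * norm (g y))"
      using gn lborel_integral_translation(2)[of "\<lambda>x. norm (g x)"] by (simp add: add.commute)
  qed measurable
  have H_le: "\<bar>H v y t\<bar> \<le> norm (g (y + t)) * norm (g y)" for v y t
    unfolding H_def by (rule order_trans[OF Cauchy_Schwarz_ineq2]) (simp add: norm_mult)
  have "(norm (qft g v))\<^sup>2 = (\<integral>y. \<integral>t. H v y t \<partial>lborel \<partial>lborel)" for v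
    unfolding H_def by (rule norm_qft_squared[OF assms(1) g])
  moreover have "(\<integral>y. \<integral>t. H v y t \<partial>lborel \<partial>lborel) = (\<integral>(y, t). H v y t \<partial>?M)" for v
  proof (rule lborel_pair.integral_fst)
    have "(\<lambda>(y, t). H v y t) \<in> borel_measurable ?M"
      unfolding H_def by measurable
    then show "integrable ?M (\<lambda>(y, t). H v y t)"
      using H_le by (intro Bochner_Integration.integrable_bound[OF K]) auto
  qed
  ultimately have qft_eq: "(norm (qft g v))\<^sup>2 = (\<integral>(y, t). H v y t \<partial>?M)" for v
    by simp
  have int: "integrable (lborel \<Otimes>\<^sub>M ?M) (\<lambda>(v, p). W v * (case p of (y, t) \<Rightarrow> H v y t))"
  proof (rule Bochner_Integration.integrable_bound[OF P.integrable_mult_pair[OF W K]])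
    show "AE x in lborel \<Otimes>\<^sub>M ?M. norm (case x of (v, p) \<Rightarrow> W v * (case p of (y, t) \<Rightarrow> H v y t))
        \<le> norm (case x of (v, p) \<Rightarrow> W v * (case p of (y, t) \<Rightarrow> norm (g (y + t)) * norm (g y)))"
      using H_le by (intro AE_I2) (auto simp: abs_mult split: prod.splits intro!: mult_left_mono)
    show "(\<lambda>(v, p). W v * (case p of (y, t) \<Rightarrow> H v y t)) \<in> borel_measurable (lborel \<Otimes>\<^sub>M ?M)"
      unfolding H_def by measurable
  qed
  have inner_int: "(\<integral>v. W v * H v y t \<partial>lborel)
      = 2 * pi / s\<^sup>2 * exp (- (norm t / s)\<^sup>2 / 2) * inner (g (y + t)) (g y)" for y t
  proof -
    \<comment> \<open>The exponents carry a minus sign, hence the evaluation at \<open>- t\<close>;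
      the result depends only on its norm.\<close>
    have "has_bochner_integral lborel (\<lambda>v. W v * H v y t)
      (2 * pi / s\<^sup>2 * exp (- (norm (- t) / s)\<^sup>2 / 2) * inner (g (y + t)) (g y))"
      using has_bochner_integral_inner_left[OF gaussian_quat_fourier[OF s, of "- t" "g (y + t)"], of "g y"]
      by (simp add: W_def H_def)
    then show ?thesis
      by (simp add: has_bochner_integral_iff)
  qed
  have "(\<integral>v. W v * (norm (qft g v))\<^sup>2 \<partial>lborel) = (\<integral>v. \<integral>p. W v * (case p of (y, t) \<Rightarrow> H v y t) \<partial>?M \<partial>lborel)"
    by (simp add: qft_eq)
  also have "\<dots> = (\<integral>p. \<integral>v. W v * (case p of (y, t) \<Rightarrow> H v y t) \<partial>lborel \<partial>?M)"
    by (rule P.Fubini_integral[symmetric, OF int])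
  also have "\<dots> = (\<integral>(y, t). 2 * pi / s\<^sup>2 * exp (- (norm t / s)\<^sup>2 / 2) * inner (g (y + t)) (g y) \<partial>?M)"
    by (intro Bochner_Integration.integral_cong) (auto simp: inner_int)
  also have "\<dots> = (\<integral>t. \<integral>y. 2 * pi / s\<^sup>2 * exp (- (norm t / s)\<^sup>2 / 2) * inner (g (y + t)) (g y) \<partial>lborel \<partial>lborel)"
  proof (rule lborel_pair.integral_snd[symmetric])
    have *: "\<bar>exp (- (norm t / s)\<^sup>2 / 2) * inner (g (y + t)) (g y)\<bar> \<le> 1 * (norm (g (y + t)) * norm (g y))" for t y
      unfolding abs_mult by (intro mult_mono Cauchy_Schwarz_ineq2) auto
    have "integrable ?M (\<lambda>(y, t). exp (- (norm t / s)\<^sup>2 / 2) * inner (g (y + t)) (g y))"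
      by (rule Bochner_Integration.integrable_bound[OF K]) (use * in auto)
    then have "integrable ?M (\<lambda>p. 2 * pi / s\<^sup>2 * (case p of (y, t) \<Rightarrow> exp (- (norm t / s)\<^sup>2 / 2) * inner (g (y + t)) (g y)))"
      by (rule integrable_mult_right)
    then show "integrable ?M (\<lambda>(y, t). 2 * pi / s\<^sup>2 * exp (- (norm t / s)\<^sup>2 / 2) * inner (g (y + t)) (g y))"
      by (simp add: split_beta' mult.assoc)
  qed
  also have "\<dots> = (LBINT t. 2 * pi / s\<^sup>2 * exp (- (norm t / s)\<^sup>2 / 2) * autocorrelation g t)"
    by (simp add: autocorrelation_def add.commute)
  finally have "(\<integral>v. W v * (norm (qft g v))\<^sup>2 \<partial>lborel) = (LBINT t. 2 * pi / s\<^sup>2 * exp (- (norm t / s)\<^sup>2 / 2) * autocorrelation g t)" .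
  moreover have "integrable lborel (\<lambda>v. W v * (norm (qft g v))\<^sup>2)"
    using P.integrable_fst[OF int] by (simp add: qft_eq)
  ultimately show ?thesis
    by (simp add: has_bochner_integral_iff W_def)
qed

text \<open>As \<open>s\<close> tends to zero, the weights on the frequency side increase to 1 and
  monotone convergence applies. On the other side the Gaussian in \<open>t\<close> keeps its mass
  and concentrates at the origin, where the autocorrelation is continuous with the squared norm as
  its value.\<close>

theorem qft_plancherel:
  assumes [measurable]: "g \<in> borel_measurable borel" and g: "integrable lborel g"
    and L2: "integrable lborel (\<lambda>x. (norm (g x))\<^sup>2)"
  shows "(\<integral>\<^sup>+v. (norm (qft g v))\<^sup>2 \<partial>lborel) = ennreal ((2 * pi)\<^sup>2 * (LBINT x. (norm (g x))\<^sup>2))"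
proof -
  define s where "s n = 1 / real (Suc n)" for n
  have s: "s n > 0" for n
    by (simp add: s_def)
  define A where "A = (LBINT x. (norm (g x))\<^sup>2)"
  define I where "I n = (LBINT t. 2 * pi / (s n)\<^sup>2 * exp (- (norm t / s n)\<^sup>2 / 2) * autocorrelation g t)" for n
  have [measurable]: "autocorrelation g \<in> borel_measurable borel"
    unfolding autocorrelation_def[abs_def] by measurable
  have [measurable]: "qft g \<in> borel_measurable borel"
    unfolding qft_def[abs_def] by measurable
  \<comment> \<open>The substitution \<open>t = s n *\<^sub>R z\<close> has Jacobian
    \<open>(s n)\<^sup>2\<close> in two dimensions, which cancels the prefactor and leaves a
    Gaussian independent of \<open>n\<close>.\<close>
  have I: "I n = (LBINT z. 2 * pi * exp (- (norm z)\<^sup>2 / 2) * autocorrelation g (s n *\<^sub>R z))" for n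
  proof -
    have L: "lborel = density (distr lborel borel (\<lambda>x::real^2. 0 + s n *\<^sub>R x)) (\<lambda>_. \<bar>s n\<bar> ^ 2)"
      using lborel_affine[of "s n" "0 :: real^2"] s[of n] by simp
    show ?thesis
      unfolding I_def
      by (subst L, subst integral_density, simp, simp, simp, subst integral_distr)
        (use s[of n] in \<open>auto simp: power2_eq_square field_simps intro!: Bochner_Integration.integral_cong\<close>)
  qed
  have "I \<longlonglongrightarrow> (LBINT z::real^2. 2 * pi * exp (- (norm z)\<^sup>2 / 2) * A)"
    unfolding I
  proof (rule integral_dominated_convergence[where w="\<lambda>z. 2 * pi * exp (- (norm z)\<^sup>2 / 2) * A"])
    show "integrable lborel (\<lambda>z::real^2. 2 * pi * exp (- (norm z)\<^sup>2 / 2) * A)"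
      using gaussian_integrable(1)[of 1] by simp
    show "AE z in lborel. norm (2 * pi * exp (- (norm z)\<^sup>2 / 2) * autocorrelation g (s n *\<^sub>R z))
        \<le> 2 * pi * exp (- (norm z)\<^sup>2 / 2) * A" for n
      using abs_autocorrelation_le[OF assms(1) L2] by (auto simp: abs_mult A_def)
    show "AE z in lborel. (\<lambda>n. 2 * pi * exp (- (norm z)\<^sup>2 / 2) * autocorrelation g (s n *\<^sub>R z))
        \<longlonglongrightarrow> 2 * pi * exp (- (norm z)\<^sup>2 / 2) * A"
    proof (intro AE_I2 tendsto_mult_left)
      fix z :: "real^2"
      have "s \<longlonglongrightarrow> 0"
        unfolding s_def by (rule LIMSEQ_Suc[OF lim_1_over_n])
      then have "(\<lambda>n. s n *\<^sub>R z) \<longlonglongrightarrow> 0 *\<^sub>R z"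
        by (intro tendsto_intros)
      then show "(\<lambda>n. autocorrelation g (s n *\<^sub>R z)) \<longlonglongrightarrow> A"
        unfolding A_def using autocorrelation_tendsto[OF assms(1) L2] by simp
    qed
  qed measurable
  \<comment> \<open>One \<open>2 * pi\<close> comes from the Fourier transform of the weight, the
    other is the mass of the limiting Gaussian.\<close>
  also have "(LBINT z::real^2. 2 * pi * exp (- (norm z)\<^sup>2 / 2) * A) = (2 * pi)\<^sup>2 * A"
    using gaussian_integrable[of 1] by (simp add: power2_eq_square)
  finally have lim: "(\<lambda>n. ennreal (I n)) \<longlonglongrightarrow> ennreal ((2 * pi)\<^sup>2 * A)"
    by (rule tendsto_ennrealI)
  have "ennreal (I n) = (\<integral>\<^sup>+v. exp (- (s n * norm v)\<^sup>2 / 2) * (norm (qft g v))\<^sup>2 \<partial>lborel)" for n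
    using weighted_plancherel[OF assms(1) g s[of n]]
    by (subst nn_integral_eq_integral) (auto simp: has_bochner_integral_iff I_def)
  moreover have "(\<lambda>n. \<integral>\<^sup>+v. exp (- (s n * norm v)\<^sup>2 / 2) * (norm (qft g v))\<^sup>2 \<partial>lborel)
      \<longlonglongrightarrow> (\<integral>\<^sup>+v. (norm (qft g v))\<^sup>2 \<partial>lborel)"
  proof (rule nn_integral_LIMSEQ)
    have "s m \<ge> s n" if "m \<le> n" for m n
      using that by (simp add: s_def frac_le)
    then show "incseq (\<lambda>n v. ennreal (exp (- (s n * norm v)\<^sup>2 / 2) * (norm (qft g v))\<^sup>2))"
      using s by (auto simp: incseq_def le_fun_def intro!: ennreal_leI mult_right_mono power_mono mult_mono
          less_imp_le[OF s] mult_nonneg_nonneg)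
    show "(\<lambda>n. ennreal (exp (- (s n * norm v)\<^sup>2 / 2) * (norm (qft g v))\<^sup>2))
        \<longlonglongrightarrow> ennreal ((norm (qft g v))\<^sup>2)" for v
    proof (rule tendsto_ennrealI)
      have "s \<longlonglongrightarrow> 0"
        unfolding s_def by (rule LIMSEQ_Suc[OF lim_1_over_n])
      then have "(\<lambda>n. exp (- (s n * norm v)\<^sup>2 / 2) * (norm (qft g v))\<^sup>2)
          \<longlonglongrightarrow> exp (- (0 * norm v)\<^sup>2 / 2) * (norm (qft g v))\<^sup>2"
        by (intro tendsto_intros) auto
      then show "(\<lambda>n. exp (- (s n * norm v)\<^sup>2 / 2) * (norm (qft g v))\<^sup>2) \<longlonglongrightarrow> (norm (qft g v))\<^sup>2"
        by simp
    qed
  qed measurable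
  ultimately show ?thesis
    using LIMSEQ_unique[OF _ lim] by (simp add: A_def)
qed

section \<open>Plancherel for the linear canonical transform\<close>

definition qlct :: "real^2^2 \<Rightarrow> real^2^2 \<Rightarrow> (real^2 \<Rightarrow> quat) \<Rightarrow> real^2 \<Rightarrow> quat" where
  "qlct A1 A2 g w = (\<integral>x. qlct_kernel qi A1 (x $ 1) (w $ 1) * g x * qlct_kernel qj A2 (x $ 2) (w $ 2) \<partial>lborel)"

text \<open>All factors commute, so their order can be chosen: the chirp in \<open>x\<close> comes
  to stand next to the transformed function and the factor depending only on \<open>w\<close>
  outermost, where it can leave the integral. The first form serves a kernel on the left, the second
  one on the right.\<close>

lemma qlct_kernel_factor:
  fixes A :: "real^2^2" and u :: quat
  assumes u: "u * u = -1" "qcnj u = - u"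
  obtains k :: "real \<Rightarrow> quat" where
    "\<And>x w. qlct_kernel u A x w = k w * exp ((- (x * (w / A$1$2))) *\<^sub>R u) * exp ((A$1$1 / A$1$2 * x\<^sup>2 / 2) *\<^sub>R u)"
    "\<And>x w. qlct_kernel u A x w = exp ((A$1$1 / A$1$2 * x\<^sup>2 / 2) *\<^sub>R u) * exp ((- (x * (w / A$1$2))) *\<^sub>R u) * k w"
    "\<And>w. norm (k w) = 1 / sqrt (2 * pi * \<bar>A$1$2\<bar>)"
proof -
  define r where "r w = (A$2$2 / A$1$2 * w\<^sup>2 - pi / 2) / 2" for w
  define k where "k w = inverse (qsqrt u (2 * pi * A$1$2)) * exp (r w *\<^sub>R u)" for w
  have K: "qlct_kernel u A x w = inverse (qsqrt u (2 * pi * A$1$2)) *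
      exp ((r w + - (x * (w / A$1$2)) + A$1$1 / A$1$2 * x\<^sup>2 / 2) *\<^sub>R u)" for x w
    unfolding qlct_kernel_def Let_def r_def inverse_eq_divide
    by (rule arg_cong[where f="\<lambda>t. 1 / qsqrt u (2 * pi * A$1$2) * exp (t *\<^sub>R u)"])
      (simp add: algebra_simps add_divide_distrib diff_divide_distrib)
  show thesis
  proof (rule that[of k])
    show "qlct_kernel u A x w = k w * exp ((- (x * (w / A$1$2))) *\<^sub>R u) * exp ((A$1$1 / A$1$2 * x\<^sup>2 / 2) *\<^sub>R u)" for x w
      unfolding K k_def exp_scaleR_add by (simp only: mult.assoc)
    have "qlct_kernel u A x w = exp ((A$1$1 / A$1$2 * x\<^sup>2 / 2 + - (x * (w / A$1$2)) + r w) *\<^sub>R u) * inverse (qsqrt u (2 * pi * A$1$2))" for x w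
      unfolding K inverse_qsqrt_commute[OF u(1)] by (simp only: add_ac)
    then show "qlct_kernel u A x w = exp ((A$1$1 / A$1$2 * x\<^sup>2 / 2) *\<^sub>R u) * exp ((- (x * (w / A$1$2))) *\<^sub>R u) * k w" for x w
      unfolding k_def exp_scaleR_add inverse_qsqrt_commute[OF u(1)] by (simp only: mult.assoc)
    show "norm (k w) = 1 / sqrt (2 * pi * \<bar>A$1$2\<bar>)" for w
      unfolding k_def norm_mult norm_inverse norm_qsqrt[OF u(1)] norm_exp_imaginary_unit[OF u]
      by (simp add: abs_mult field_simps)
  qed
qed

lemma nn_integral_lborel_scale2:
  fixes F :: "real^2 \<Rightarrow> ennreal"
  assumes [measurable]: "F \<in> borel_measurable borel" and b: "b1 \<noteq> 0" "b2 \<noteq> 0"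
  shows "(\<integral>\<^sup>+w. F (vector [(w::real^2) $ 1 / b1, w $ 2 / b2]) \<partial>lborel) = ennreal \<bar>b1 * b2\<bar> * (\<integral>\<^sup>+v. F v \<partial>lborel)"
proof -
  define c where "c j = (if j = axis (1::2) (1::real) then b1 else b2)" for j
  \<comment> \<open>\<open>T\<close> is the inverse dilation: after substituting it the argument of
    \<open>F\<close> is \<open>v\<close> itself, and \<open>\<bar>b1 * b2\<bar>\<close> is its
    Jacobian.\<close>
  define T where "T x = (0::real^2) + (\<Sum>j\<in>Basis. (c j * inner x j) *\<^sub>R j)" for x :: "real^2"
  have ne: "axis (2::2) (1::real) \<noteq> axis 1 1"
    by (simp add: axis_eq_axis)
  have B: "(Basis :: (real^2) set) = {axis 1 1, axis 2 1}"
    by (auto simp: Basis_vec_def UNIV_2)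
  have c: "c j \<noteq> 0" for j
    using b by (simp add: c_def)
  have [measurable]: "T \<in> borel_measurable borel"
    unfolding T_def by measurable
  have m: "(\<lambda>w::real^2. vector [w $ 1 / b1, w $ 2 / b2] :: real^2) \<in> borel_measurable borel"
  proof -
    have "(\<lambda>w::real^2. vector [w $ 1 / b1, w $ 2 / b2] :: real^2)
        = (\<lambda>w. (w $ 1 / b1) *\<^sub>R axis 1 1 + (w $ 2 / b2) *\<^sub>R axis 2 1)"
      by (auto simp: vec_eq_iff forall_2 axis_def)
    then show ?thesis
      by simp
  qed
  note [measurable] = m
  have Tv: "T v = (b1 * v $ 1) *\<^sub>R axis 1 1 + (b2 * v $ 2) *\<^sub>R axis 2 1" for v
    using ne by (simp add: T_def B c_def inner_axis)
  have TT: "vector [T v $ 1 / b1, T v $ 2 / b2] = v" for v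
    using b unfolding Tv by (simp add: vec_eq_iff forall_2 axis_def)
  have D: "(\<Prod>j\<in>(Basis::(real^2) set). \<bar>c j\<bar>) = \<bar>b1 * b2\<bar>"
    using ne by (simp add: B c_def abs_mult)
  have L: "lborel = density (distr lborel borel T) (\<lambda>_. \<bar>b1 * b2\<bar>)"
    using lborel_affine_euclidean[of c "0::real^2"] c unfolding T_def D by simp
  show ?thesis
    by (subst L, subst nn_integral_density, simp, simp, subst nn_integral_distr)
      (simp_all add: TT nn_integral_cmult)
qed

text \<open>The transform is the Fourier transform of the chirped function \<open>h\<close> at a
  dilated frequency, between two factors of constant modulus. Their squared moduli multiply to
  \<open>1 / ((2 * pi)\<^sup>2 * \<bar>b1 * b2\<bar>)\<close>, which cancels the Fourier constant
  and the Jacobian of the dilation.\<close>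

theorem qlct_plancherel:
  assumes b: "A1$1$2 \<noteq> 0" "A2$1$2 \<noteq> 0"
    and [measurable]: "g \<in> borel_measurable borel" and g: "integrable lborel g"
    and L2: "integrable lborel (\<lambda>x. (norm (g x))\<^sup>2)"
  shows "(\<integral>\<^sup>+w. (norm (qlct A1 A2 g w))\<^sup>2 \<partial>lborel) = (\<integral>\<^sup>+x. (norm (g x))\<^sup>2 \<partial>lborel)"
proof -
  define b1 b2 where "b1 = A1$1$2" and "b2 = A2$1$2"
  have b0: "b1 \<noteq> 0" "b2 \<noteq> 0"
    using b by (simp_all add: b1_def b2_def)
  obtain k1 where k1: "\<And>x w. qlct_kernel qi A1 x w = k1 w * exp ((- (x * (w / A1$1$2))) *\<^sub>R qi) * exp ((A1$1$1 / A1$1$2 * x\<^sup>2 / 2) *\<^sub>R qi)"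
    and nk1: "\<And>w. norm (k1 w) = 1 / sqrt (2 * pi * \<bar>A1$1$2\<bar>)"
    by (rule qlct_kernel_factor[OF unit_qi, of A1]) (blast intro: that)
  obtain k2 where k2: "\<And>x w. qlct_kernel qj A2 x w = exp ((A2$1$1 / A2$1$2 * x\<^sup>2 / 2) *\<^sub>R qj) * exp ((- (x * (w / A2$1$2))) *\<^sub>R qj) * k2 w"
    and nk2: "\<And>w. norm (k2 w) = 1 / sqrt (2 * pi * \<bar>A2$1$2\<bar>)"
    by (rule qlct_kernel_factor[OF unit_qj, of A2]) (blast intro: that)
  define h where "h x = exp ((A1$1$1 / A1$1$2 * (x $ 1)\<^sup>2 / 2) *\<^sub>R qi) * g x * exp ((A2$1$1 / A2$1$2 * (x $ 2)\<^sup>2 / 2) *\<^sub>R qj)" for x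
  have [measurable]: "h \<in> borel_measurable borel"
    unfolding h_def by measurable
  have nh: "norm (h x) = norm (g x)" for x
    by (simp add: h_def norm_mult)
  have h: "integrable lborel h"
    by (rule Bochner_Integration.integrable_bound[OF g]) (auto simp: nh)
  define E where "E x v = exp ((- (x $ 1 * v $ 1)) *\<^sub>R qi) * h x * exp ((- (x $ 2 * v $ 2)) *\<^sub>R qj)" for x v :: "real^2"
  have E: "integrable lborel (\<lambda>x. E x v)" for v
  proof (rule Bochner_Integration.integrable_bound[OF h])
    show "(\<lambda>x. E x v) \<in> borel_measurable lborel"
      unfolding E_def by measurable
    show "AE x in lborel. norm (E x v) \<le> norm (h x)"
      by (simp add: E_def norm_mult)
  qed
  have "qlct A1 A2 g w = k1 (w $ 1) * qft h (vector [w $ 1 / b1, w $ 2 / b2]) * k2 (w $ 2)" for w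
  proof -
    have "qlct_kernel qi A1 (x $ 1) (w $ 1) * g x * qlct_kernel qj A2 (x $ 2) (w $ 2)
        = k1 (w $ 1) * E x (vector [w $ 1 / b1, w $ 2 / b2]) * k2 (w $ 2)" for x
      unfolding k1 k2 by (simp add: E_def h_def b1_def b2_def mult.assoc)
    then have "qlct A1 A2 g w = (\<integral>x. k1 (w $ 1) * E x (vector [w $ 1 / b1, w $ 2 / b2]) * k2 (w $ 2) \<partial>lborel)"
      by (simp add: qlct_def)
    also have "\<dots> = k1 (w $ 1) * (\<integral>x. E x (vector [w $ 1 / b1, w $ 2 / b2]) \<partial>lborel) * k2 (w $ 2)"
      using E by simp
    finally show ?thesis
      by (simp add: qft_def E_def)
  qed
  then have n: "(norm (qlct A1 A2 g w))\<^sup>2 = 1 / ((2 * pi)\<^sup>2 * \<bar>b1 * b2\<bar>) * (norm (qft h (vector [w $ 1 / b1, w $ 2 / b2])))\<^sup>2" for w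
    by (simp add: norm_mult nk1 nk2 power_mult_distrib power_divide abs_mult b1_def b2_def real_sqrt_pow2_iff
        power2_eq_square[of pi])
  have [measurable]: "qft h \<in> borel_measurable borel"
    unfolding qft_def[abs_def] by measurable
  have "(\<integral>\<^sup>+w. (norm (qlct A1 A2 g w))\<^sup>2 \<partial>lborel)
      = (\<integral>\<^sup>+w. ennreal (1 / ((2 * pi)\<^sup>2 * \<bar>b1 * b2\<bar>)) * ennreal ((norm (qft h (vector [(w::real^2) $ 1 / b1, w $ 2 / b2])))\<^sup>2) \<partial>lborel)"
    unfolding n by (simp flip: ennreal_mult')
  also have "\<dots> = ennreal \<bar>b1 * b2\<bar> * (\<integral>\<^sup>+v. ennreal (1 / ((2 * pi)\<^sup>2 * \<bar>b1 * b2\<bar>)) * ennreal ((norm (qft h v))\<^sup>2) \<partial>lborel)"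
    by (rule nn_integral_lborel_scale2[OF _ b0]) measurable
  also have "\<dots> = ennreal \<bar>b1 * b2\<bar> * (ennreal (1 / ((2 * pi)\<^sup>2 * \<bar>b1 * b2\<bar>)) * ennreal ((2 * pi)\<^sup>2 * (LBINT x. (norm (g x))\<^sup>2)))"
    using L2 by (subst nn_integral_cmult) (simp_all add: qft_plancherel[OF _ h] nh)
  also have "\<dots> = ennreal (LBINT x. (norm (g x))\<^sup>2)"
    using b0 by (simp flip: ennreal_mult')
  also have "\<dots> = (\<integral>\<^sup>+x. (norm (g x))\<^sup>2 \<partial>lborel)"
    using L2 by (subst nn_integral_eq_integral) auto
  finally show ?thesis .
qed

section \<open>The Gabor transform with a Borel window\<close>

lemma mult_le_add_squares:
  fixes a b :: real
  assumes "0 \<le> a" "0 \<le> b" shows "a * b \<le> a\<^sup>2 + b\<^sup>2"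
  using sum_squares_bound[of a b] mult_nonneg_nonneg[OF assms] by linarith

lemma lborel_distr_reflect: "distr lborel borel (\<lambda>y. x - y) = (lborel :: 'a::euclidean_space measure)"
proof -
  have "lborel = density (distr lborel borel (\<lambda>y. x + (- 1) *\<^sub>R y)) (\<lambda>_. ennreal (\<bar>- 1\<bar> ^ DIM('a)))"
    by (rule lborel_affine) simp
  then show ?thesis
    by (simp add: density_1)
qed

lemma
  fixes F :: "'a::euclidean_space \<Rightarrow> 'b::euclidean_space"
  assumes [measurable]: "F \<in> borel_measurable borel"
  shows lborel_integral_reflect: "(\<integral>y. F (x - y) \<partial>lborel) = (\<integral>y. F y \<partial>lborel)"
    and lborel_integrable_reflect: "integrable lborel (\<lambda>y. F (x - y)) \<longleftrightarrow> integrable lborel F"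
  using integral_distr[of "\<lambda>y. x - y" lborel borel F] integrable_distr_eq[of "\<lambda>y. x - y" lborel borel F]
  by (simp_all add: lborel_distr_reflect)

lemma integrable_inner_L2:
  fixes u v :: "'x \<Rightarrow> quat"
  assumes [measurable]: "u \<in> borel_measurable M" "v \<in> borel_measurable M"
    and "integrable M (\<lambda>x. (norm (u x))\<^sup>2)" "integrable M (\<lambda>x. (norm (v x))\<^sup>2)"
  shows "integrable M (\<lambda>x. inner (u x) (v x))"
proof (rule Bochner_Integration.integrable_bound)
  show "integrable M (\<lambda>x. (norm (u x))\<^sup>2 + (norm (v x))\<^sup>2)"
    using assms by simp
  have "\<bar>inner (u x) (v x)\<bar> \<le> (norm (u x))\<^sup>2 + (norm (v x))\<^sup>2" for x
    by (rule order_trans[OF Cauchy_Schwarz_ineq2 mult_le_add_squares]) auto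
  then show "AE x in M. norm (inner (u x) (v x)) \<le> norm ((norm (u x))\<^sup>2 + (norm (v x))\<^sup>2)"
    by (auto intro: order_trans[OF _ abs_ge_self])
qed measurable

locale gabor_window =
  fixes A1 A2 :: "real^2^2" and \<phi> :: "real^2 \<Rightarrow> quat"
  assumes b: "A1$1$2 \<noteq> 0" "A2$1$2 \<noteq> 0"
    and window_measurable [measurable]: "\<phi> \<in> borel_measurable borel"
    and window_L2: "integrable lborel (\<lambda>x. (norm (\<phi> x))\<^sup>2)"
begin

text \<open>The parameter is the pair of frequency and window position. At a fixed position this is
  the canonical transform of one windowed slice, so that Plancherel can be applied slice by
  slice.\<close>

definition G :: "(real^2 \<Rightarrow> quat) \<Rightarrow> (real^2) \<times> (real^2) \<Rightarrow> quat" where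
  "G f p = qlct A1 A2 (\<lambda>x. f x * qcnj (\<phi> (x - snd p))) (fst p)"

definition energy :: real where "energy = (LBINT x. (norm (\<phi> x))\<^sup>2)"

definition kernel_bound :: real where
  "kernel_bound = 1 / sqrt (2 * pi * \<bar>A1$1$2\<bar>) * (1 / sqrt (2 * pi * \<bar>A2$1$2\<bar>))"

lemma energy_nonneg: "0 \<le> energy"
  by (simp add: energy_def)

lemma measurable_G [measurable]:
  assumes [measurable]: "f \<in> borel_measurable borel"
  shows "G f \<in> borel_measurable (lborel \<Otimes>\<^sub>M lborel)"
  unfolding G_def[abs_def] qlct_def by measurable

lemma window_translate:
  "integrable lborel (\<lambda>y. (norm (\<phi> (x - y)))\<^sup>2)" "(LBINT y. (norm (\<phi> (x - y)))\<^sup>2) = energy"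
  "integrable lborel (\<lambda>x. (norm (\<phi> (x - y)))\<^sup>2)"
  using window_L2 lborel_integral_reflect[of "\<lambda>x. (norm (\<phi> x))\<^sup>2" x]
    lborel_integrable_reflect[of "\<lambda>x. (norm (\<phi> x))\<^sup>2" x]
    lborel_integral_translation(2)[of "\<lambda>x. (norm (\<phi> x))\<^sup>2" "- y"]
  by (auto simp: energy_def)

lemma slice_integrable:
  assumes [measurable]: "f \<in> borel_measurable borel" and f: "integrable lborel (\<lambda>x. (norm (f x))\<^sup>2)"
  shows "integrable lborel (\<lambda>x. f x * qcnj (\<phi> (x - y)))"
proof (rule Bochner_Integration.integrable_bound)
  show "integrable lborel (\<lambda>x. (norm (f x))\<^sup>2 + (norm (\<phi> (x - y)))\<^sup>2)"
    using f window_translate(3) by (rule Bochner_Integration.integrable_add)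
  have "norm (f x) * norm (\<phi> (x - y)) \<le> (norm (f x))\<^sup>2 + (norm (\<phi> (x - y)))\<^sup>2" for x
    by (rule mult_le_add_squares) auto
  then show "AE x in lborel. norm (f x * qcnj (\<phi> (x - y))) \<le> norm ((norm (f x))\<^sup>2 + (norm (\<phi> (x - y)))\<^sup>2)"
    by (auto simp: norm_mult intro: order_trans[OF _ abs_ge_self])
qed measurable

lemma kernel_slice_integrable:
  assumes [measurable]: "f \<in> borel_measurable borel" and f: "integrable lborel (\<lambda>x. (norm (f x))\<^sup>2)"
  shows "integrable lborel (\<lambda>x. qlct_kernel qi A1 (x $ 1) w1 * (f x * qcnj (\<phi> (x - y))) * qlct_kernel qj A2 (x $ 2) w2)"
proof (rule Bochner_Integration.integrable_bound)
  show "integrable lborel (\<lambda>x. kernel_bound *\<^sub>R (f x * qcnj (\<phi> (x - y))))"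
    using slice_integrable[OF assms] by simp
  show "AE x in lborel. norm (qlct_kernel qi A1 (x $ 1) w1 * (f x * qcnj (\<phi> (x - y))) * qlct_kernel qj A2 (x $ 2) w2)
      \<le> norm (kernel_bound *\<^sub>R (f x * qcnj (\<phi> (x - y))))"
    by (simp add: norm_mult norm_qlct_kernel kernel_bound_def)
qed measurable

lemma G_add:
  assumes [measurable]: "f \<in> borel_measurable borel" "h \<in> borel_measurable borel"
    and f: "integrable lborel (\<lambda>x. (norm (f x))\<^sup>2)" and h: "integrable lborel (\<lambda>x. (norm (h x))\<^sup>2)"
  shows "G (\<lambda>x. f x + h x) p = G f p + G h p"
  unfolding G_def qlct_def
  by (subst Bochner_Integration.integral_add[OF kernel_slice_integrable[OF _ f] kernel_slice_integrable[OF _ h], symmetric])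
    (auto intro!: Bochner_Integration.integral_cong simp: algebra_simps)

section \<open>Energy identity and orthogonality relation\<close>

text \<open>Plancherel at each window position, integrated over the positions. By Tonelli the
  squared slices may be integrated over \<open>y\<close> first, which yields \<open>energy\<close>
  whatever \<open>x\<close> is.\<close>

lemma nn_energy_identity:
  assumes [measurable]: "f \<in> borel_measurable borel" and f: "integrable lborel (\<lambda>x. (norm (f x))\<^sup>2)"
  shows "(\<integral>\<^sup>+p. (norm (G f p))\<^sup>2 \<partial>(lborel \<Otimes>\<^sub>M lborel)) = ennreal (energy * (LBINT x. (norm (f x))\<^sup>2))"
proof -
  define g where "g y x = f x * qcnj (\<phi> (x - y))" for x y
  have [measurable]: "(\<lambda>(y, x). g y x) \<in> borel_measurable (lborel \<Otimes>\<^sub>M lborel)" "g y \<in> borel_measurable borel" for y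
    unfolding g_def by measurable
  have total: "(\<integral>\<^sup>+y. \<integral>\<^sup>+x. (norm (g y x))\<^sup>2 \<partial>lborel \<partial>lborel) = ennreal (energy * (LBINT x. (norm (f x))\<^sup>2))"
  proof -
    have "(\<integral>\<^sup>+y. \<integral>\<^sup>+x. (norm (g y x))\<^sup>2 \<partial>lborel \<partial>lborel)
        = (\<integral>\<^sup>+x. \<integral>\<^sup>+y. (norm (g y x))\<^sup>2 \<partial>lborel \<partial>lborel)"
      by (rule lborel_pair.Fubini') measurable
    also have "\<dots> = (\<integral>\<^sup>+x. \<integral>\<^sup>+y. ennreal ((norm (f x))\<^sup>2) * ennreal ((norm (\<phi> (x - y)))\<^sup>2) \<partial>lborel \<partial>lborel)"
      by (simp add: g_def norm_mult power_mult_distrib ennreal_mult')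
    also have "\<dots> = (\<integral>\<^sup>+x. ennreal ((norm (f x))\<^sup>2) * ennreal energy \<partial>lborel)"
      using window_translate
      by (simp add: nn_integral_cmult nn_integral_eq_integral)
    also have "\<dots> = ennreal (LBINT x. (norm (f x))\<^sup>2) * ennreal energy"
      using f by (simp add: nn_integral_multc nn_integral_eq_integral)
    finally show ?thesis
      by (simp add: ennreal_mult' energy_nonneg mult.commute)
  qed
  \<comment> \<open>Finiteness of the total makes the slice square-integrable for almost every
    position; this is enough, as the identity is then integrated over \<open>y\<close>.\<close>
  have "AE y in lborel. (\<integral>\<^sup>+x. (norm (g y x))\<^sup>2 \<partial>lborel) \<noteq> \<infinity>"
    by (rule nn_integral_noteq_infinite) (simp_all add: total)
  then have ae: "AE y in lborel. (\<integral>\<^sup>+w. (norm (G f (w, y)))\<^sup>2 \<partial>lborel) = (\<integral>\<^sup>+x. (norm (g y x))\<^sup>2 \<partial>lborel)"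
  proof eventually_elim
    fix y assume "(\<integral>\<^sup>+x. (norm (g y x))\<^sup>2 \<partial>lborel) \<noteq> \<infinity>"
    then have "integrable lborel (\<lambda>x. (norm (g y x))\<^sup>2)"
      by (simp add: integrable_iff_bounded less_top)
    from qlct_plancherel[OF b _ _ this]
    show "(\<integral>\<^sup>+w. (norm (G f (w, y)))\<^sup>2 \<partial>lborel) = (\<integral>\<^sup>+x. (norm (g y x))\<^sup>2 \<partial>lborel)"
      using slice_integrable[OF assms, of y] by (simp add: G_def g_def[abs_def])
  qed
  have "(\<integral>\<^sup>+p. (norm (G f p))\<^sup>2 \<partial>(lborel \<Otimes>\<^sub>M lborel))
      = (\<integral>\<^sup>+y. \<integral>\<^sup>+w. (norm (G f (w, y)))\<^sup>2 \<partial>lborel \<partial>lborel)"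
    by (rule lborel_pair.nn_integral_snd[symmetric]) measurable
  also have "\<dots> = (\<integral>\<^sup>+y. \<integral>\<^sup>+x. (norm (g y x))\<^sup>2 \<partial>lborel \<partial>lborel)"
    by (rule nn_integral_cong_AE[OF ae])
  finally show ?thesis
    by (simp add: total)
qed

lemma energy_identity:
  assumes "f \<in> borel_measurable borel" and "integrable lborel (\<lambda>x. (norm (f x))\<^sup>2)"
  shows "has_bochner_integral (lborel \<Otimes>\<^sub>M lborel) (\<lambda>p. (norm (G f p))\<^sup>2) (energy * (LBINT x. (norm (f x))\<^sup>2))"
  using assms
  by (intro has_bochner_integral_nn_integral nn_energy_identity) (auto simp: energy_nonneg)

text \<open>Polarisation of the energy identity, which suffices because the inner product is real
  and \<open>G\<close> is additive.\<close>

lemma G_orthogonality: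
  assumes [measurable]: "f \<in> borel_measurable borel" "h \<in> borel_measurable borel"
    and f: "integrable lborel (\<lambda>x. (norm (f x))\<^sup>2)" and h: "integrable lborel (\<lambda>x. (norm (h x))\<^sup>2)"
  shows "has_bochner_integral (lborel \<Otimes>\<^sub>M lborel) (\<lambda>p. inner (G f p) (G h p)) (energy * (LBINT x. inner (f x) (h x)))"
proof -
  have i: "integrable lborel (\<lambda>x. inner (f x) (h x))"
    using f h by (intro integrable_inner_L2) auto
  have sq: "(norm (p + q))\<^sup>2 = (norm p)\<^sup>2 + (norm q)\<^sup>2 + 2 * inner p q" for p q :: quat
    by (simp add: power2_norm_eq_inner inner_add inner_commute)
  have fh: "integrable lborel (\<lambda>x. (norm (f x + h x))\<^sup>2)"
    unfolding sq using f h i by simp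
  have "has_bochner_integral (lborel \<Otimes>\<^sub>M lborel)
      (\<lambda>p. ((norm (G (\<lambda>x. f x + h x) p))\<^sup>2 - (norm (G f p))\<^sup>2 - (norm (G h p))\<^sup>2) / 2)
      ((energy * (LBINT x. (norm (f x + h x))\<^sup>2) - energy * (LBINT x. (norm (f x))\<^sup>2)
        - energy * (LBINT x. (norm (h x))\<^sup>2)) / 2)"
    by (intro has_bochner_integral_divide has_bochner_integral_diff energy_identity f h fh) auto
  also have "((energy * (LBINT x. (norm (f x + h x))\<^sup>2) - energy * (LBINT x. (norm (f x))\<^sup>2)
        - energy * (LBINT x. (norm (h x))\<^sup>2)) / 2) = energy * (LBINT x. inner (f x) (h x))"
    unfolding sq using f h i by (simp add: algebra_simps)
  also have "(\<lambda>p. ((norm (G (\<lambda>x. f x + h x) p))\<^sup>2 - (norm (G f p))\<^sup>2 - (norm (G h p))\<^sup>2) / 2)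
      = (\<lambda>p. inner (G f p) (G h p))"
    by (simp add: G_add[OF _ _ f h] sq)
  finally show ?thesis .
qed

section \<open>Synthesis over a parameter set as an adjoint\<close>

text \<open>The integrand of the inversion formula, for a fixed \<open>x\<close> as a function of \<open>p = (\<omega>, y)\<close>.\<close>

definition synth :: "(real^2 \<Rightarrow> quat) \<Rightarrow> real^2 \<Rightarrow> (real^2) \<times> (real^2) \<Rightarrow> quat" where
  "synth f x p = qlct_kernel (- qi) A1 (x $ 1) (fst p $ 1) * G f p *
     qlct_kernel (- qj) A2 (x $ 2) (fst p $ 2) * \<phi> (x - snd p)"

lemma measurable_synth [measurable]:
  assumes [measurable]: "f \<in> borel_measurable borel"
  shows "(\<lambda>(x, p). synth f x p) \<in> borel_measurable (lborel \<Otimes>\<^sub>M (lborel \<Otimes>\<^sub>M lborel))"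
  unfolding synth_def by measurable

lemma norm_synth: "norm (synth f x p) = kernel_bound * (norm (G f p) * norm (\<phi> (x - snd p)))"
  by (simp add: synth_def kernel_bound_def norm_mult qlct_kernel_minus norm_qlct_kernel)

lemma kernel_bound_nonneg: "0 \<le> kernel_bound"
  by (simp add: kernel_bound_def)

text \<open>Moved to the test vector \<open>q\<close>, the conjugated kernels become the original
  ones, and the window, rightmost in the synthesis integrand, lands conjugated next to
  \<open>q\<close>. This is exactly the order of factors in the transform of a test
  function.\<close>

lemma inner_synth:
  "inner (synth f x p) q = inner (G f p)
     (qlct_kernel qi A1 (x $ 1) (fst p $ 1) * (q * qcnj (\<phi> (x - snd p))) * qlct_kernel qj A2 (x $ 2) (fst p $ 2))"
proof -
  have eq: "synth f x p = qcnj (qlct_kernel qi A1 (x $ 1) (fst p $ 1)) * G f p *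
      (qcnj (qlct_kernel qj A2 (x $ 2) (fst p $ 2)) * \<phi> (x - snd p))"
    by (simp add: synth_def qlct_kernel_minus mult.assoc)
  show ?thesis
    unfolding eq inner_qmult qcnj_mult qcnj_qcnj by (simp only: mult.assoc)
qed

lemma integral_inner_synth:
  assumes [measurable]: "h \<in> borel_measurable borel" and h: "integrable lborel (\<lambda>x. (norm (h x))\<^sup>2)"
  shows "(LBINT x. inner (synth f x p) (h x)) = inner (G f p) (G h p)"
  unfolding inner_synth using kernel_slice_integrable[OF assms]
  by (simp add: G_def qlct_def mult.assoc)

text \<open>No cut-off in \<open>y\<close> is required, since the squared window has integral
  \<open>energy\<close> over \<open>y\<close> for every \<open>x\<close>. The cut-off in
  \<open>x\<close> in the second part will come from the support of a test function.\<close>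

lemma cutoff_integrable:
  fixes N R :: real
  defines "F \<equiv> \<lambda>(x::real^2) (p::(real^2) \<times> (real^2)). indicator (cball 0 R) (fst p) * (norm (\<phi> (x - snd p)))\<^sup>2 :: real"
  shows "integrable (lborel \<Otimes>\<^sub>M lborel) (F x)"
    and "integrable (lborel \<Otimes>\<^sub>M (lborel \<Otimes>\<^sub>M lborel)) (\<lambda>(x, p). indicator (cball (0::real^2) N) x * F x p)"
proof -
  let ?M = "lborel \<Otimes>\<^sub>M lborel :: ((real^2) \<times> (real^2)) measure"
  interpret P: pair_sigma_finite "lborel :: (real^2) measure" ?M
    by (intro pair_sigma_finite.intro) (simp_all add: lborel_prod lborel.sigma_finite_measure_axioms)
  have [measurable]: "cball (0::real^2) r \<in> sets borel" for r
    by simp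
  have ball: "integrable lborel (indicator (cball (0::real^2) r) :: _ \<Rightarrow> real)" for r
    using emeasure_lborel_cball_finite[of "0::real^2" r] by (simp add: integrable_indicator_iff)
  have F: "F x = (\<lambda>(w, y). indicator (cball 0 R) w * (norm (\<phi> (x - y)))\<^sup>2)" for x
    by (auto simp: F_def)
  show 1: "integrable ?M (F x)" for x
    unfolding F by (intro lborel_pair.integrable_mult_pair ball window_translate)
  have "(\<integral>p. F x p \<partial>?M) = (LBINT w::real^2. LBINT y. indicator (cball 0 R) w * (norm (\<phi> (x - y)))\<^sup>2)" for x
    using lborel_pair.integral_fst'[OF 1[of x], symmetric] by (simp add: F_def)
  then have 2: "(\<integral>p. F x p \<partial>?M) = (LBINT w::real^2. indicator (cball 0 R) w * energy)" for x
    by (simp add: window_translate)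
  have F0: "0 \<le> F x p" for x p
    by (simp add: F_def)
  show "integrable (lborel \<Otimes>\<^sub>M ?M) (\<lambda>(x, p). indicator (cball (0::real^2) N) x * F x p)"
  proof (rule P.Fubini_integrable)
    show "(\<lambda>(x, p). indicator (cball (0::real^2) N) x * F x p) \<in> borel_measurable (lborel \<Otimes>\<^sub>M ?M)"
      unfolding F_def by measurable
    show "integrable lborel (\<lambda>x. \<integral>p. norm (case (x, p) of (x, p) \<Rightarrow> indicator (cball (0::real^2) N) x * F x p) \<partial>?M)"
      using ball by (simp add: abs_mult F0 2)
    show "AE x in lborel. integrable ?M (\<lambda>p. case (x, p) of (x, p) \<Rightarrow> indicator (cball (0::real^2) N) x * F x p)"
      using 1 by simp
  qed
qed

text \<open>The sum separates two terms that are integrable for different reasons: the energy of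
  \<open>G f\<close> over all parameters, and the squared window over a ball of frequencies.\<close>

lemma norm_synth_le: "norm (synth f x p) \<le> kernel_bound * ((norm (G f p))\<^sup>2 + (norm (\<phi> (x - snd p)))\<^sup>2)"
  unfolding norm_synth by (intro mult_left_mono mult_le_add_squares kernel_bound_nonneg norm_ge_zero)

lemma integrable_synth:
  assumes [measurable]: "f \<in> borel_measurable borel" and f: "integrable lborel (\<lambda>x. (norm (f x))\<^sup>2)"
    and K [measurable]: "K \<in> sets (lborel \<Otimes>\<^sub>M lborel)" and KR: "K \<subseteq> cball 0 R \<times> UNIV"
  shows "integrable (lborel \<Otimes>\<^sub>M lborel) (\<lambda>p. indicator K p *\<^sub>R synth f x p)"
proof (rule Bochner_Integration.integrable_bound)
  show "integrable (lborel \<Otimes>\<^sub>M lborel)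
      (\<lambda>p. kernel_bound * ((norm (G f p))\<^sup>2 + indicator (cball 0 R) (fst p) * (norm (\<phi> (x - snd p)))\<^sup>2))"
    using energy_identity[OF assms(1) f] cutoff_integrable(1)
    by (intro integrable_mult_right Bochner_Integration.integrable_add) (auto simp: has_bochner_integral_iff)
  have "norm (indicator K p *\<^sub>R synth f x p)
      \<le> kernel_bound * ((norm (G f p))\<^sup>2 + indicator (cball 0 R) (fst p) * (norm (\<phi> (x - snd p)))\<^sup>2)" for p
    using norm_synth_le[of f x p] KR kernel_bound_nonneg by (auto simp: indicator_def)
  then show "AE p in lborel \<Otimes>\<^sub>M lborel. norm (indicator K p *\<^sub>R synth f x p)
      \<le> norm (kernel_bound * ((norm (G f p))\<^sup>2 + indicator (cball 0 R) (fst p) * (norm (\<phi> (x - snd p)))\<^sup>2))"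
    by (intro AE_I2) (auto intro: order_trans[OF _ abs_ge_self])
qed measurable

text \<open>Weak form of the statement that synthesis over \<open>K\<close> is the adjoint of the
  transform restricted to \<open>K\<close>. Boundedness and bounded support of \<open>h\<close> make
  the integrand absolutely integrable in \<open>x\<close> and \<open>p\<close> jointly, so Fubini's
  theorem swaps the integrals.\<close>

lemma synth_test:
  assumes [measurable]: "f \<in> borel_measurable borel" and f: "integrable lborel (\<lambda>x. (norm (f x))\<^sup>2)"
    and K [measurable]: "K \<in> sets (lborel \<Otimes>\<^sub>M lborel)" and KR: "K \<subseteq> cball 0 R \<times> UNIV"
    and N0: "0 \<le> N" and h_meas [measurable]: "h \<in> borel_measurable borel" and hN: "\<And>x. norm (h x) \<le> N * indicator (cball 0 N) x"
    and h: "integrable lborel (\<lambda>x. (norm (h x))\<^sup>2)"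
  shows "(LBINT x. inner (\<integral>p. indicator K p *\<^sub>R synth f x p \<partial>(lborel \<Otimes>\<^sub>M lborel)) (h x))
    = (\<integral>p. indicator K p * inner (G f p) (G h p) \<partial>(lborel \<Otimes>\<^sub>M lborel))"
    and "integrable lborel (\<lambda>x. inner (\<integral>p. indicator K p *\<^sub>R synth f x p \<partial>(lborel \<Otimes>\<^sub>M lborel)) (h x))"
proof -
  let ?M = "lborel \<Otimes>\<^sub>M lborel :: ((real^2) \<times> (real^2)) measure"
  interpret P: pair_sigma_finite "lborel :: (real^2) measure" ?M
    by (intro pair_sigma_finite.intro) (simp_all add: lborel_prod lborel.sigma_finite_measure_axioms)
  have [measurable]: "cball (0::real^2) r \<in> sets borel" for r
    by simp
  have ball: "integrable lborel (indicator (cball (0::real^2) r) :: _ \<Rightarrow> real)" for r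
    using emeasure_lborel_cball_finite[of "0::real^2" r] by (simp add: integrable_indicator_iff)
  define B where "B x p = kernel_bound * N * (indicator (cball 0 N) x * (norm (G f p))\<^sup>2
      + indicator (cball 0 N) x * (indicator (cball 0 R) (fst p) * (norm (\<phi> (x - snd p)))\<^sup>2))" for x p
  have E: "integrable ?M (\<lambda>p. (norm (G f p))\<^sup>2)"
    using energy_identity[OF assms(1) f] by (simp add: has_bochner_integral_iff)
  have "integrable (lborel \<Otimes>\<^sub>M ?M) (\<lambda>q. kernel_bound * N * ((case q of (x, p) \<Rightarrow> indicator (cball 0 N) x * (norm (G f p))\<^sup>2)
      + (case q of (x, p) \<Rightarrow> indicator (cball 0 N) x * (indicator (cball 0 R) (fst p) * (norm (\<phi> (x - snd p)))\<^sup>2))))"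
    by (intro integrable_mult_right Bochner_Integration.integrable_add cutoff_integrable(2) P.integrable_mult_pair ball E)
  then have B: "integrable (lborel \<Otimes>\<^sub>M ?M) (\<lambda>(x, p). B x p)"
    by (simp add: B_def split_beta')
  define T where "T x p = inner (indicator K p *\<^sub>R synth f x p) (h x)" for x p
  have TB: "\<bar>T x p\<bar> \<le> B x p" for x p
  proof (cases "p \<in> K")
    case True
    then have p: "fst p \<in> cball 0 R"
      using KR by auto
    have "\<bar>T x p\<bar> \<le> norm (synth f x p) * norm (h x)"
      using True Cauchy_Schwarz_ineq2 by (simp add: T_def)
    also have "\<dots> \<le> (kernel_bound * ((norm (G f p))\<^sup>2 + (norm (\<phi> (x - snd p)))\<^sup>2)) * (N * indicator (cball 0 N) x)"
      by (intro mult_mono norm_synth_le hN mult_nonneg_nonneg kernel_bound_nonneg) auto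
    also have "\<dots> = B x p"
      using p by (simp add: B_def algebra_simps)
    finally show ?thesis .
  next
    case False
    then show ?thesis
      using N0 kernel_bound_nonneg by (auto simp: T_def B_def intro!: mult_nonneg_nonneg add_nonneg_nonneg)
  qed
  have int: "integrable (lborel \<Otimes>\<^sub>M ?M) (\<lambda>(x, p). T x p)"
  proof (rule Bochner_Integration.integrable_bound[OF B])
    show "(\<lambda>(x, p). T x p) \<in> borel_measurable (lborel \<Otimes>\<^sub>M ?M)"
      unfolding T_def by measurable
    show "AE q in lborel \<Otimes>\<^sub>M ?M. norm (case q of (x, p) \<Rightarrow> T x p) \<le> norm (case q of (x, p) \<Rightarrow> B x p)"
      using TB by (intro AE_I2) (auto intro: order_trans[OF _ abs_ge_self])
  qed
  have eq: "inner (\<integral>p. indicator K p *\<^sub>R synth f x p \<partial>?M) (h x) = (\<integral>p. T x p \<partial>?M)" for x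
    unfolding T_def using integrable_synth[OF assms(1) f K KR] by (intro integral_inner_left[symmetric]) auto
  show "integrable lborel (\<lambda>x. inner (\<integral>p. indicator K p *\<^sub>R synth f x p \<partial>?M) (h x))"
    unfolding eq by (rule P.integrable_fst[OF int])
  have "(LBINT x. inner (\<integral>p. indicator K p *\<^sub>R synth f x p \<partial>?M) (h x)) = (\<integral>p. \<integral>x. T x p \<partial>lborel \<partial>?M)"
    unfolding eq by (rule P.Fubini_integral[OF int, symmetric])
  also have "\<dots> = (\<integral>p. indicator K p * inner (G f p) (G h p) \<partial>?M)"
    unfolding T_def using integral_inner_synth[OF h_meas h] by simp
  finally show "(LBINT x. inner (\<integral>p. indicator K p *\<^sub>R synth f x p \<partial>?M) (h x))
    = (\<integral>p. indicator K p * inner (G f p) (G h p) \<partial>?M)" .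
qed

text \<open>Against a test function \<open>h\<close> the error gives minus the integral of
  \<open>inner (G f p) (G h p)\<close> over the complement of \<open>K\<close>. Taking for
  \<open>h\<close> a truncation of the error itself turns this into a norm bound;
  square-integrability of the error is not presupposed but results in the limit.\<close>

lemma synthesis_error:
  assumes [measurable]: "f \<in> borel_measurable borel" and f: "integrable lborel (\<lambda>x. (norm (f x))\<^sup>2)"
    and K [measurable]: "K \<in> sets (lborel \<Otimes>\<^sub>M lborel)" and KR: "K \<subseteq> cball 0 R \<times> UNIV"
    and e: "energy > 0"
  defines "D \<equiv> \<lambda>x. (\<integral>p. indicator K p *\<^sub>R synth f x p \<partial>(lborel \<Otimes>\<^sub>M lborel)) - energy *\<^sub>R f x"
  shows "D \<in> borel_measurable borel"
    and "(\<integral>\<^sup>+x. (norm (D x))\<^sup>2 \<partial>lborel)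
      \<le> ennreal (energy * (\<integral>p. indicator (- K) p * (norm (G f p))\<^sup>2 \<partial>(lborel \<Otimes>\<^sub>M lborel)))"
proof -
  let ?M = "lborel \<Otimes>\<^sub>M lborel :: ((real^2) \<times> (real^2)) measure"
  interpret P: pair_sigma_finite "lborel :: (real^2) measure" ?M
    by (intro pair_sigma_finite.intro) (simp_all add: lborel_prod lborel.sigma_finite_measure_axioms)
  define S where "S x = (\<integral>p. indicator K p *\<^sub>R synth f x p \<partial>?M)" for x
  have [measurable]: "S \<in> borel_measurable borel"
  proof -
    have "(\<lambda>(x, p). indicator K p *\<^sub>R synth f x p) \<in> borel_measurable (lborel \<Otimes>\<^sub>M ?M)"
      by measurable
    moreover have "sigma_finite_measure ?M"
      by (simp add: lborel_prod lborel.sigma_finite_measure_axioms)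
    ultimately have "(\<lambda>x. \<integral>p. indicator K p *\<^sub>R synth f x p \<partial>?M) \<in> borel_measurable lborel"
      using sigma_finite_measure.borel_measurable_lebesgue_integral by blast
    then show ?thesis
      by (simp add: S_def[abs_def])
  qed
  have D: "D x = S x - energy *\<^sub>R f x" for x
    by (simp add: D_def S_def)
  show D_meas: "D \<in> borel_measurable borel"
    unfolding D[abs_def] by measurable
  note [measurable] = D_meas
  define E where "E = (\<integral>p. indicator (- K) p * (norm (G f p))\<^sup>2 \<partial>?M)"
  have Gf: "integrable ?M (\<lambda>p. (norm (G f p))\<^sup>2)"
    using energy_identity[OF assms(1) f] by (simp add: has_bochner_integral_iff)
  have KC [measurable]: "- K \<in> sets ?M"
    using sets.compl_sets[OF K] by (simp add: space_pair_measure Compl_eq_Diff_UNIV)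
  have GE: "integrable ?M (\<lambda>p. indicator (- K) p * (norm (G f p))\<^sup>2)"
    using integrable_mult_indicator[OF KC Gf] by simp
  \<comment> \<open>Truncating both argument and value makes \<open>h N\<close> an admissible test
    function of finite norm, and \<open>inner (D x) (h N x)\<close> is still
    \<open>(norm (h N x))\<^sup>2\<close>.\<close>
  define h where "h N x = indicator {x. norm x \<le> real N \<and> norm (D x) \<le> real N} x *\<^sub>R D x" for N x
  have [measurable]: "h N \<in> borel_measurable borel" for N
    unfolding h_def by measurable
  have hN: "norm (h N x) \<le> real N * indicator (cball 0 (real N)) x" for N x
    by (auto simp: h_def indicator_def)
  have h: "integrable lborel (\<lambda>x. (norm (h N x))\<^sup>2)" for N
  proof (rule Bochner_Integration.integrable_bound)
    show "integrable lborel (\<lambda>x::real^2. (real N)\<^sup>2 * indicator (cball 0 (real N)) x)"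
      using emeasure_lborel_cball_finite[of "0::real^2" "real N"] by (intro integrable_mult_right) (simp add: integrable_indicator_iff)
    have "(norm (h N x))\<^sup>2 \<le> (real N)\<^sup>2 * indicator (cball 0 (real N)) x" for x
      using hN[of N x] by (cases "x \<in> cball 0 (real N)") auto
    then show "AE x in lborel. norm ((norm (h N x))\<^sup>2) \<le> norm ((real N)\<^sup>2 * indicator (cball 0 (real N)) x)"
      by (intro AE_I2) simp
  qed measurable
  have bound: "(LBINT x. (norm (h N x))\<^sup>2) \<le> energy * E" for N
  proof -
    define H where "H = (LBINT x. (norm (h N x))\<^sup>2)"
    have Gh: "has_bochner_integral ?M (\<lambda>p. (norm (G (h N) p))\<^sup>2) (energy * H)"
      unfolding H_def by (rule energy_identity[OF _ h]) measurable
    have GG: "has_bochner_integral ?M (\<lambda>p. inner (G f p) (G (h N) p)) (energy * (LBINT x. inner (f x) (h N x)))"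
      by (rule G_orthogonality[OF _ _ f h]) measurable
    have KGG: "integrable ?M (\<lambda>p. indicator K p * inner (G f p) (G (h N) p))"
      using integrable_mult_indicator[OF K has_bochner_integral_iff[THEN iffD1, THEN conjunct1, OF GG]] by simp
    note test = synth_test[OF assms(1) f K KR of_nat_0_le_iff _ hN h, folded S_def]
    have "H = (LBINT x. inner (S x) (h N x) - energy * inner (f x) (h N x))"
      unfolding H_def
      by (intro Bochner_Integration.integral_cong)
        (auto simp: h_def D indicator_def power2_norm_eq_inner inner_diff_left)
    also have "\<dots> = (LBINT x. inner (S x) (h N x)) - energy * (LBINT x. inner (f x) (h N x))"
      using test(2) integrable_inner_L2[OF _ _ f h, of N] by simp
    also have "\<dots> = (\<integral>p. indicator K p * inner (G f p) (G (h N) p) \<partial>?M) - (\<integral>p. inner (G f p) (G (h N) p) \<partial>?M)"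
      using test(1) GG by (simp add: has_bochner_integral_iff)
    also have "\<dots> = (\<integral>p. indicator K p * inner (G f p) (G (h N) p) - inner (G f p) (G (h N) p) \<partial>?M)"
      using KGG GG by (simp add: has_bochner_integral_iff)
    \<comment> \<open>Young's inequality with weight \<open>energy\<close>: by the energy identity
      for \<open>h N\<close> the second term integrates to \<open>H / 2\<close>, which is absorbed
      on the left and leaves \<open>H \<le> energy * E\<close>.\<close>
    also have "\<dots> \<le> (\<integral>p. energy / 2 * (indicator (- K) p * (norm (G f p))\<^sup>2) + (norm (G (h N) p))\<^sup>2 / (2 * energy) \<partial>?M)"
    proof (rule integral_mono)
      show "integrable ?M (\<lambda>p. indicator K p * inner (G f p) (G (h N) p) - inner (G f p) (G (h N) p))"
        using KGG GG by (simp add: has_bochner_integral_iff)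
      show "integrable ?M (\<lambda>p. energy / 2 * (indicator (- K) p * (norm (G f p))\<^sup>2) + (norm (G (h N) p))\<^sup>2 / (2 * energy))"
        using GE Gh by (simp add: has_bochner_integral_iff)
      fix p
      have "0 \<le> (energy * norm (G f p) - norm (G (h N) p))\<^sup>2 / (2 * energy)"
        using e by simp
      also have "\<dots> = energy / 2 * (norm (G f p))\<^sup>2 + (norm (G (h N) p))\<^sup>2 / (2 * energy) - norm (G f p) * norm (G (h N) p)"
        using e by (simp add: power2_eq_square field_simps)
      finally have "- inner (G f p) (G (h N) p) \<le> energy / 2 * (norm (G f p))\<^sup>2 + (norm (G (h N) p))\<^sup>2 / (2 * energy)"
        using Cauchy_Schwarz_ineq2[of "G f p" "G (h N) p"] by linarith
      then show "indicator K p * inner (G f p) (G (h N) p) - inner (G f p) (G (h N) p)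
          \<le> energy / 2 * (indicator (- K) p * (norm (G f p))\<^sup>2) + (norm (G (h N) p))\<^sup>2 / (2 * energy)"
        using e by (cases "p \<in> K") auto
    qed
    also have "\<dots> = energy / 2 * E + H / 2"
      using GE Gh e by (simp add: has_bochner_integral_iff E_def)
    finally show ?thesis
      by (simp add: H_def)
  qed
  \<comment> \<open>The bound does not depend on \<open>N\<close>, so monotone convergence removes
    the truncation.\<close>
  have "(\<lambda>N. \<integral>\<^sup>+x. (norm (h N x))\<^sup>2 \<partial>lborel) \<longlonglongrightarrow> (\<integral>\<^sup>+x. (norm (D x))\<^sup>2 \<partial>lborel)"
  proof (rule nn_integral_LIMSEQ)
    show "incseq (\<lambda>N x. ennreal ((norm (h N x))\<^sup>2))"
      by (auto simp: incseq_def le_fun_def h_def indicator_def)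
    show "(\<lambda>N. ennreal ((norm (h N x))\<^sup>2)) \<longlonglongrightarrow> ennreal ((norm (D x))\<^sup>2)" for x
    proof (rule tendsto_eventually)
      obtain N0 :: nat where "norm x + norm (D x) \<le> N0"
        using real_arch_simple by blast
      then have "h N x = D x" if "N \<ge> N0" for N
      proof -
        have "norm x \<le> real N \<and> norm (D x) \<le> real N"
          using \<open>norm x + norm (D x) \<le> N0\<close> that norm_ge_zero[of x] norm_ge_zero[of "D x"] by linarith
        then show ?thesis
          by (simp add: h_def)
      qed
      then show "\<forall>\<^sub>F N in sequentially. ennreal ((norm (h N x))\<^sup>2) = ennreal ((norm (D x))\<^sup>2)"
        unfolding eventually_sequentially by (intro exI[of _ N0]) simp
    qed
  qed measurable
  moreover have "(\<integral>\<^sup>+x. (norm (h N x))\<^sup>2 \<partial>lborel) \<le> ennreal (energy * E)" for N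
    using bound[of N] h by (subst nn_integral_eq_integral) (auto intro: ennreal_leI)
  ultimately show "(\<integral>\<^sup>+x. (norm (D x))\<^sup>2 \<partial>lborel)
      \<le> ennreal (energy * (\<integral>p. indicator (- K) p * (norm (G f p))\<^sup>2 \<partial>?M))"
    unfolding E_def[symmetric] by (intro LIMSEQ_le_const2) auto
qed

end

section \<open>From Borel to Lebesgue measurable functions\<close>

lemma integrable_norm_add_L2:
  fixes u v :: "'x \<Rightarrow> quat"
  assumes [measurable]: "u \<in> borel_measurable M" "v \<in> borel_measurable M"
    and u: "integrable M (\<lambda>x. (norm (u x))\<^sup>2)" and v: "integrable M (\<lambda>x. (norm (v x))\<^sup>2)"
  shows "integrable M (\<lambda>x. (norm (u x + v x))\<^sup>2)"
proof -
  have "(norm (u x + v x))\<^sup>2 = (norm (u x))\<^sup>2 + (norm (v x))\<^sup>2 + 2 * inner (u x) (v x)" for x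
    by (simp add: power2_norm_eq_inner inner_add inner_commute)
  then show ?thesis
    using u v integrable_inner_L2[OF assms] by simp
qed

text \<open>Each coordinate agrees almost everywhere with a real Borel function; finitely many null
  sets are discarded and the coordinates are reassembled.\<close>

lemma lebesgue_borel_version:
  fixes f :: "'a::euclidean_space \<Rightarrow> 'b::euclidean_space"
  assumes "f \<in> borel_measurable lebesgue"
  obtains f' where "f' \<in> borel_measurable borel" "AE x in lborel. f x = f' x"
proof -
  have "\<forall>e. \<exists>g\<in>borel_measurable lborel. AE x in lborel. inner (f x) e = g x"
    using assms by (intro allI completion_ex_borel_measurable_real borel_measurable_inner borel_measurable_const)
  then obtain g where g: "\<And>e. g e \<in> borel_measurable lborel" "\<And>e. AE x in lborel. inner (f x) e = g e x"
    by metis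
  have [measurable]: "g e \<in> borel_measurable borel" for e
    using g(1)[of e] by simp
  have "AE x in lborel. \<forall>e\<in>Basis. inner (f x) e = g e x"
    using g(2) by (simp add: AE_ball_countable countable_finite)
  then have "AE x in lborel. f x = (\<Sum>e\<in>Basis. g e x *\<^sub>R e)"
    by eventually_elim (subst euclidean_representation[symmetric], simp)
  then show thesis
    by (rule that[rotated]) measurable
qed

lemma lebesgue_AE_borel:
  fixes f :: "'a::euclidean_space \<Rightarrow> 'b::euclidean_space"
  assumes f': "f' \<in> borel_measurable borel" and ae: "AE x in lborel. f x = f' x"
  shows "f \<in> borel_measurable lebesgue" "integral\<^sup>L lebesgue f = integral\<^sup>L lborel f'"
    "integrable lebesgue f \<longleftrightarrow> integrable lborel f'"
proof -
  have m': "f' \<in> borel_measurable lebesgue" and l': "f' \<in> borel_measurable lborel"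
    using f' by (simp_all add: measurable_completion)
  have ae': "AE x in lebesgue. f x = f' x"
    using ae by (rule AE_completion)
  then show m: "f \<in> borel_measurable lebesgue"
    using borel_measurable_AE[OF m', of f] by (simp add: eq_commute)
  show "integral\<^sup>L lebesgue f = integral\<^sup>L lborel f'"
    using integral_cong_AE[OF m m' ae'] integral_completion[OF l'] by simp
  show "integrable lebesgue f \<longleftrightarrow> integrable lborel f'"
    using integrable_cong_AE[OF m m' ae'] integrable_completion[OF l'] by simp
qed

lemma L2_quat_AE_borel:
  assumes [measurable]: "f' \<in> borel_measurable borel" and ae: "AE x in lborel. f x = f' x"
  shows L2_quat_AE_iff: "L2_quat f \<longleftrightarrow> integrable lborel (\<lambda>x. (norm (f' x))\<^sup>2)"
    and L2_norm_AE_eq: "L2_norm f = sqrt (LBINT x. (norm (f' x))\<^sup>2)"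
proof -
  have ae2: "AE x in lborel. (norm (f x))\<^sup>2 = (norm (f' x))\<^sup>2"
    using ae by eventually_elim simp
  have m: "(\<lambda>x. (norm (f' x))\<^sup>2) \<in> borel_measurable borel"
    by measurable
  show "L2_quat f \<longleftrightarrow> integrable lborel (\<lambda>x. (norm (f' x))\<^sup>2)"
    using lebesgue_AE_borel(1)[OF assms] lebesgue_AE_borel(3)[OF m ae2] by (simp add: L2_quat_def)
  show "L2_norm f = sqrt (LBINT x. (norm (f' x))\<^sup>2)"
    using lebesgue_AE_borel(2)[OF m ae2] by (simp add: L2_norm_def)
qed

section \<open>Null sets under reflection, translation and projection\<close>

lemma AE_lborel_reflect:
  fixes x :: "'a::euclidean_space"
  assumes "AE y in lborel. P y" shows "AE y in lborel. P (x - y)"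
proof -
  have "AE y in distr lborel borel (\<lambda>y. x - y). P y"
    using assms by (simp only: lborel_distr_reflect)
  then show ?thesis
    by (rule AE_distrD[rotated]) simp
qed

lemma AE_lborel_translate:
  fixes y :: "'a::euclidean_space"
  assumes "AE x in lborel. P x" shows "AE x in lborel. P (x - y)"
proof -
  have "AE x in distr lborel borel ((+) (- y)). P x"
    using assms by (simp only: lborel_distr_plus)
  then have "AE x in lborel. P (- y + x)"
    by (rule AE_distrD[rotated]) simp
  then show ?thesis
    by simp
qed

lemma AE_lborel_snd:
  assumes "AE y in lborel. P y"
  shows "AE p in lborel. P (snd (p :: 'a::euclidean_space \<times> 'b::euclidean_space))"
proof -
  obtain N where N: "{y. \<not> P y} \<subseteq> N" "N \<in> sets lborel" "emeasure lborel N = 0"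
    using assms by (auto simp: eventually_ae_filter null_sets_def)
  have "emeasure (lborel \<Otimes>\<^sub>M lborel) ((UNIV :: 'a set) \<times> N) = 0"
    using N by (subst lborel.emeasure_pair_measure_Times) auto
  then have "UNIV \<times> N \<in> null_sets (lborel :: ('a \<times> 'b) measure)"
    using N by (auto simp: null_sets_def lborel_prod[symmetric] intro!: pair_measureI)
  then show ?thesis
    by (rule AE_I') (use N(1) in auto)
qed

text \<open>The Borel set is taken inside \<open>K\<close> so that it inherits boundedness.\<close>

lemma lebesgue_set_borel_version:
  assumes "K \<in> sets (lebesgue :: 'a::euclidean_space measure)"
  obtains K' where "K' \<in> sets borel" "K' \<subseteq> K" "AE p in lborel. p \<in> K \<longleftrightarrow> p \<in> K'"
proof -
  obtain S N N' where K: "K = S \<union> N" "N \<subseteq> N'" "N' \<in> null_sets lborel" "S \<in> sets lborel"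
    using assms by (rule sets_completionE)
  have "AE p in lborel. p \<notin> N'"
    using K(3) by (rule AE_not_in)
  then have "AE p in lborel. p \<in> K \<longleftrightarrow> p \<in> S"
    by eventually_elim (use K in auto)
  with K show thesis
    by (intro that[of S]) auto
qed

section \<open>The inversion formula\<close>

theorem theorem2p5:
  fixes A1 A2 :: "real^2^2" and \<phi> f :: "real^2 \<Rightarrow> quat"
  assumes "det A1 = 1" and "det A2 = 1"
    and "A1 $ 1 $ 2 * A2 $ 1 $ 2 \<noteq> 0"
    and "L2_quat \<phi>" and "\<not> (AE x in lebesgue. \<phi> x = 0)"
    and "L2_quat f"
  shows "\<exists>I. has_L2_integral
               (\<lambda>(\<omega>, y) x. qlct_kernel (- qi) A1 (x $ 1) (\<omega> $ 1) * gabor_qlct A1 A2 \<phi> f \<omega> y *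
                  qlct_kernel (- qj) A2 (x $ 2) (\<omega> $ 2) * \<phi> (x - y)) I \<and>
             (AE x in lebesgue. f x = (1 / (L2_norm \<phi>)\<^sup>2) *\<^sub>R I x)"
proof -
  obtain \<phi>' where \<phi>' [measurable]: "\<phi>' \<in> borel_measurable borel" and ae\<phi>: "AE x in lborel. \<phi> x = \<phi>' x"
    using assms(4) by (auto simp: L2_quat_def intro: lebesgue_borel_version)
  obtain f' where f' [measurable]: "f' \<in> borel_measurable borel" and aef: "AE x in lborel. f x = f' x"
    using assms(6) by (auto simp: L2_quat_def intro: lebesgue_borel_version)
  have f2: "integrable lborel (\<lambda>x. (norm (f' x))\<^sup>2)"
    using L2_quat_AE_iff[OF f' aef] assms(6) by simp
  interpret gabor_window A1 A2 \<phi>'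
    using assms(3,4) L2_quat_AE_iff[OF \<phi>' ae\<phi>] by unfold_locales auto
  let ?M = "lborel \<Otimes>\<^sub>M lborel :: ((real^2) \<times> (real^2)) measure"
  have M: "?M = lborel"
    by (rule lborel_prod)
  have norm_\<phi>: "(L2_norm \<phi>)\<^sup>2 = energy"
    using L2_norm_AE_eq[OF \<phi>' ae\<phi>] energy_nonneg by (simp add: energy_def)
  have "energy \<noteq> 0"
  proof
    assume "energy = 0"
    then have "AE x in lborel. (norm (\<phi>' x))\<^sup>2 = 0"
      using integral_nonneg_eq_0_iff_AE[OF window_L2] by (simp add: energy_def)
    with ae\<phi> have "AE x in lborel. \<phi> x = 0"
      by eventually_elim simp
    then show False
      using assms(5) by (simp add: AE_completion)
  qed
  then have e: "energy > 0"
    using energy_nonneg by simp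
  define F where "F = (\<lambda>(\<omega>, y) x. qlct_kernel (- qi) A1 (x $ 1) (\<omega> $ 1) * gabor_qlct A1 A2 \<phi> f \<omega> y *
                  qlct_kernel (- qj) A2 (x $ 2) (\<omega> $ 2) * \<phi> (x - y))"
  \<comment> \<open>The equality holds at every \<open>(\<omega>, y)\<close>: changing
    \<open>f\<close> and the translated window on null sets does not affect an integral over
    \<open>x\<close>.\<close>
  have gabor: "gabor_qlct A1 A2 \<phi> f \<omega> y = G f' (\<omega>, y)" for \<omega> y
    unfolding gabor_qlct_def G_def qlct_def
  proof (rule lebesgue_AE_borel(2))
    show "AE x in lborel. qlct_kernel qi A1 (x $ 1) (\<omega> $ 1) * f x * qcnj (\<phi> (x - y)) * qlct_kernel qj A2 (x $ 2) (\<omega> $ 2)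
        = qlct_kernel qi A1 (x $ 1) (fst (\<omega>, y) $ 1) * (f' x * qcnj (\<phi>' (x - snd (\<omega>, y)))) * qlct_kernel qj A2 (x $ 2) (fst (\<omega>, y) $ 2)"
      using aef AE_lborel_translate[OF ae\<phi>, of y] by eventually_elim (simp add: mult.assoc)
  qed measurable
  \<comment> \<open>For each \<open>x\<close> the exceptional pairs form a cylinder over a reflected
    null set of window positions.\<close>
  have F_ae: "AE p in ?M. F p x = synth f' x p" for x
  proof -
    have "AE p in ?M. \<phi> (x - snd p) = \<phi>' (x - snd p)"
      unfolding M by (rule AE_lborel_snd[OF AE_lborel_reflect[OF ae\<phi>]])
    then show ?thesis
      by eventually_elim (simp add: F_def synth_def gabor split_beta')
  qed
  define S where "S K x = (\<integral>p. indicator K p *\<^sub>R synth f' x p \<partial>?M)" for K x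
  define D where "D K x = S K x - energy *\<^sub>R f' x" for K x
  \<comment> \<open>A bounded parameter set is exchanged for a Borel subset that differs from it by
    a null set. The final estimate, over the complement of that subset, drives the
    convergence.\<close>
  have reduce: "(\<forall>x. set_integrable lebesgue K (\<lambda>p. F p x)) \<and> (\<forall>x. (LINT p:K|lebesgue. F p x) = S K' x)
      \<and> D K' \<in> borel_measurable borel \<and> integrable lborel (\<lambda>x. (norm (D K' x))\<^sup>2)
      \<and> (LBINT x. (norm (D K' x))\<^sup>2) \<le> energy * (\<integral>p. indicator (- K') p * (norm (G f' p))\<^sup>2 \<partial>?M)"
    if K: "bounded K" and K': "K' \<in> sets borel" "K' \<subseteq> K" "AE p in lborel. p \<in> K \<longleftrightarrow> p \<in> K'" for K K'
  proof -
    have KM [measurable]: "K' \<in> sets ?M"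
      using K'(1) unfolding M by simp
    obtain R where R: "\<And>p. p \<in> K \<Longrightarrow> norm p \<le> R"
      using K by (auto simp: bounded_iff)
    have KR: "K' \<subseteq> cball 0 R \<times> UNIV"
    proof
      fix p assume "p \<in> K'"
      then have "norm (fst p) \<le> R"
        using R K'(2) norm_fst_le[of "fst p" "snd p"] by (metis order_trans prod.collapse subsetD)
      then show "p \<in> cball 0 R \<times> UNIV"
        by (cases p) simp
    qed
    have ae: "AE p in lborel. indicator K p *\<^sub>R F p x = indicator K' p *\<^sub>R synth f' x p" for x
      using K'(3) F_ae[of x, unfolded M] by eventually_elim (simp add: indicator_def)
    have meas: "(\<lambda>p. indicator K' p *\<^sub>R synth f' x p) \<in> borel_measurable borel" for x
    proof -
      have "(\<lambda>p. indicator K' p *\<^sub>R synth f' x p) \<in> borel_measurable ?M"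
        by measurable
      then show ?thesis
        unfolding M by simp
    qed
    have 1: "set_integrable lebesgue K (\<lambda>p. F p x)" for x
      unfolding set_integrable_def lebesgue_AE_borel(3)[OF meas ae]
      using integrable_synth[OF f' f2 KM KR] unfolding M .
    have 2: "(LINT p:K|lebesgue. F p x) = S K' x" for x
      unfolding set_lebesgue_integral_def lebesgue_AE_borel(2)[OF meas ae] S_def M ..
    have 3: "D K' \<in> borel_measurable borel"
      and nn: "(\<integral>\<^sup>+x. (norm (D K' x))\<^sup>2 \<partial>lborel) \<le> ennreal (energy * (\<integral>p. indicator (- K') p * (norm (G f' p))\<^sup>2 \<partial>?M))"
      using synthesis_error[OF f' f2 KM KR e] unfolding D_def[abs_def] S_def by simp_all
    note [measurable] = 3
    have 4: "integrable lborel (\<lambda>x. (norm (D K' x))\<^sup>2)"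
      using nn by (auto simp: integrable_iff_bounded intro: le_less_trans)
    have "ennreal (LBINT x. (norm (D K' x))\<^sup>2) \<le> ennreal (energy * (\<integral>p. indicator (- K') p * (norm (G f' p))\<^sup>2 \<partial>?M))"
      using nn 4 by (simp add: nn_integral_eq_integral)
    then have "(LBINT x. (norm (D K' x))\<^sup>2) \<le> energy * (\<integral>p. indicator (- K') p * (norm (G f' p))\<^sup>2 \<partial>?M)"
      using e by (subst (asm) ennreal_le_iff) (auto intro!: mult_nonneg_nonneg)
    with 1 2 3 4 show ?thesis
      by blast
  qed
  have ef2: "integrable lborel (\<lambda>x. (norm (energy *\<^sub>R f' x))\<^sup>2)"
    using f2 by (simp add: power_mult_distrib)
  \<comment> \<open>The witness is \<open>energy\<close> times \<open>f\<close>, where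
    \<open>energy\<close> is the squared norm of the window.\<close>
  have "has_L2_integral F (\<lambda>x. energy *\<^sub>R f x)"
    unfolding has_L2_integral_def
  proof (intro conjI ballI impI allI)
    show "L2_quat (\<lambda>x. energy *\<^sub>R f x)"
      using L2_quat_AE_iff[of "\<lambda>x. energy *\<^sub>R f' x" "\<lambda>x. energy *\<^sub>R f x"] aef ef2 by auto
  next
    fix K :: "((real^2) \<times> (real^2)) set" assume K: "K \<in> sets lebesgue" "bounded K"
    obtain K' where K': "K' \<in> sets borel" "K' \<subseteq> K" "AE p in lborel. p \<in> K \<longleftrightarrow> p \<in> K'"
      using K(1) by (rule lebesgue_set_borel_version)
    note red = reduce[OF K(2) K']
    from red show "AE x in lebesgue. set_integrable lebesgue K (\<lambda>p. F p x)"
      by simp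
    have [measurable]: "D K' \<in> borel_measurable borel"
      using red by simp
    \<comment> \<open>The synthesis integral is the error plus \<open>energy *\<^sub>R f'\<close>, a
      sum of two square-integrable functions.\<close>
    have "integrable lborel (\<lambda>x. (norm (D K' x + energy *\<^sub>R f' x))\<^sup>2)"
      using red ef2 by (intro integrable_norm_add_L2) auto
    then have "L2_quat (\<lambda>x. D K' x + energy *\<^sub>R f' x)"
      using L2_quat_AE_iff[of "\<lambda>x. D K' x + energy *\<^sub>R f' x" "\<lambda>x. D K' x + energy *\<^sub>R f' x"] by simp
    then show "L2_quat (\<lambda>x. LINT p:K|lebesgue. F p x)"
      using red by (simp add: D_def)
  next
    fix K :: "nat \<Rightarrow> ((real^2) \<times> (real^2)) set"
    assume "(\<forall>n. K n \<in> sets lebesgue \<and> bounded (K n)) \<and> incseq K \<and> (\<Union>n. K n) = UNIV"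
    then have K: "\<And>n. K n \<in> sets lebesgue" "\<And>n. bounded (K n)" and inc: "incseq K" and un: "(\<Union>n. K n) = UNIV"
      by auto
    have "\<exists>K'. K' \<in> sets borel \<and> K' \<subseteq> K n \<and> (AE p in lborel. p \<in> K n \<longleftrightarrow> p \<in> K')" for n
      using K(1)[of n] by (rule lebesgue_set_borel_version) blast
    then have "\<exists>K'. \<forall>n. K' n \<in> sets borel \<and> K' n \<subseteq> K n \<and> (AE p in lborel. p \<in> K n \<longleftrightarrow> p \<in> K' n)"
      by (intro choice allI)
    then obtain K' where K': "\<And>n. K' n \<in> sets borel" "\<And>n. K' n \<subseteq> K n"
        "\<And>n. AE p in lborel. p \<in> K n \<longleftrightarrow> p \<in> K' n"
      by blast
    note red = reduce[OF K(2) K']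
    define E where "E n = (\<integral>p. indicator (- K' n) p * (norm (G f' p))\<^sup>2 \<partial>?M)" for n
    have Gf: "integrable ?M (\<lambda>p. (norm (G f' p))\<^sup>2)"
      using energy_identity[OF f' f2] by (simp add: has_bochner_integral_iff)
    have "E \<longlonglongrightarrow> (\<integral>p. 0 \<partial>?M)"
      unfolding E_def
    proof (rule integral_dominated_convergence[OF _ _ Gf])
      have [measurable]: "- K' n \<in> sets ?M" for n
        using K'(1)[of n] unfolding M by simp
      show "(\<lambda>p. indicator (- K' n) p * (norm (G f' p))\<^sup>2) \<in> borel_measurable ?M" for n
        by measurable
      \<comment> \<open>The sets \<open>K' n\<close> need not increase. Off a single null set,
        membership in each of them agrees with membership in the increasing \<open>K n\<close>, so
        every remaining \<open>p\<close> lies in \<open>K' n\<close> for all large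
        \<open>n\<close>.\<close>
      have "AE p in ?M. \<forall>n. p \<in> K n \<longleftrightarrow> p \<in> K' n"
        unfolding M using K'(3) by (simp add: AE_all_countable)
      then show "AE p in ?M. (\<lambda>n. indicator (- K' n) p * (norm (G f' p))\<^sup>2) \<longlonglongrightarrow> 0"
      proof eventually_elim
        fix p assume p: "\<forall>n. p \<in> K n \<longleftrightarrow> p \<in> K' n"
        obtain m where "p \<in> K m"
          using un by blast
        then have "p \<in> K' n" if "n \<ge> m" for n
          using p incseqD[OF inc that] by blast
        then have "\<forall>\<^sub>F n in sequentially. indicator (- K' n) p * (norm (G f' p))\<^sup>2 = 0"
          unfolding eventually_sequentially by (intro exI[of _ m]) simp
        then show "(\<lambda>n. indicator (- K' n) p * (norm (G f' p))\<^sup>2) \<longlonglongrightarrow> 0"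
          by (rule tendsto_eventually)
      qed
    qed (auto simp: indicator_def)
    then have lim: "(\<lambda>n. sqrt (energy * E n)) \<longlonglongrightarrow> sqrt (energy * 0)"
      by (intro tendsto_intros) simp
    have D: "L2_norm (\<lambda>x. (LINT p:K n|lebesgue. F p x) - energy *\<^sub>R f x) = sqrt (LBINT x. (norm (D (K' n) x))\<^sup>2)" for n
    proof (rule L2_norm_AE_eq)
      show "D (K' n) \<in> borel_measurable borel"
        using red by simp
      show "AE x in lborel. (LINT p:K n|lebesgue. F p x) - energy *\<^sub>R f x = D (K' n) x"
        using aef by eventually_elim (use red in \<open>simp add: D_def\<close>)
    qed
    show "(\<lambda>n. L2_norm (\<lambda>x. (LINT p:K n|lebesgue. F p x) - energy *\<^sub>R f x)) \<longlonglongrightarrow> 0"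
      unfolding D
    proof (rule tendsto_sandwich[OF _ _ tendsto_const])
      show "(\<lambda>n. sqrt (energy * E n)) \<longlonglongrightarrow> 0"
        using lim by simp
      show "\<forall>\<^sub>F n in sequentially. sqrt (LBINT x. (norm (D (K' n) x))\<^sup>2) \<le> sqrt (energy * E n)"
        using red by (simp add: E_def)
    qed simp
  qed
  moreover have "AE x in lebesgue. f x = (1 / (L2_norm \<phi>)\<^sup>2) *\<^sub>R (energy *\<^sub>R f x)"
    using e by (simp add: norm_\<phi>)
  ultimately show ?thesis
    unfolding F_def by blast
qed

end
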